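(* Let $\mathcal R$ be a TRS, and let either ($\to\,=\,\to_{\mathcal R}$, $\mathcal P=\mathrm{WDP}(\mathcal R)$, $\mathcal G=\mathrm{WDG}(\mathcal R)$, $\Rightarrow_{\mathcal Q}\,=\,\to_{\mathcal Q}$) or ($\to\,=\,\xrightarrow{i}_{\mathcal R}$, $\mathcal P=\mathrm{WIDP}(\mathcal R)$, $\mathcal G=\mathrm{WIDG}(\mathcal R)$, $\Rightarrow_{\mathcal Q}\,=\,\xrightarrow{i}_{\mathcal Q}$). For a term $s$ define $\mathrm{Path}(s)=\max\{\mathrm{dh}(s,\Rightarrow_{\mathcal Q\cup\mathcal U(\mathcal Q)})\mid (\mathcal P_1,\dots,\mathcal P_k) \text{ is a path in the congruence graph of } \mathcal G,\ \mathcal P_1 \text{ a source node},\ \mathcal Q=\mathcal P_1\cup\dots\cup\mathcal P_k\}$. Then there is a constant $c$ such that $\mathrm{dh}(t,\to)\le c\cdot\mathrm{Path}(t^\sharp)$ for every basic term $t\in\mathcal T_{\mathsf b}$ that is terminating with respect to $\to$.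
   Context: Let $\mathcal F$ be a finite signature with at least one constant, $\mathcal V$ a countably infinite set of variables. A TRS $\mathcal R$ is a finite set of rules $l\to r$, $l\notin\mathcal V$, $\mathrm{Var}(r)\subseteq\mathrm{Var}(l)$; $\to_{\mathcal R}$ its rewrite relation; innermost rewriting $s\xrightarrow{i}_{\mathcal R}t$ iff $s=C[l\sigma]$, $t=C[r\sigma]$ for a rule $l\to r$ with all proper subterms of $l\sigma$ in normal form. Defined symbols $\mathcal D$: roots of left-hand sides; constructors $\mathcal C=\mathcal F\setminus\mathcal D$. Basic terms: $f(t_1,\dots,t_n)$ with $f\in\mathcal D$, $t_i\in\mathcal T(\mathcal C,\mathcal V)$; $\mathcal T_{\mathsf b}$ their set. $\mathrm{dh}(s,\to)=\max\{n\mid\exists t.\ s\to^n t\}$. $t^\sharp=t$ for variables and $f^\sharp(t_1,\dots,t_n)$ for $t=f(t_1,\dots,t_n)$, $f^\sharp$ fresh. For a set $X$, every term is uniquely $C[t_1,\dots,t_n]$ with $C$ an $n$-hole context without elements of $X$ and each $t_i$ rooted in $X$. $\mathrm{COM}(t_1)=t_1$, $\mathrm{COM}(t_1,\dots,t_n)=c(t_1,\dots,t_n)$ ($n\ne1$) with $c$ a fresh compound symbol. $\mathrm{WDP}(\mathcal R)$: rules $l^\sharp\to\mathrm{COM}(u_1^\sharp,\dots,u_n^\sharp)$ for $l\to r\in\mathcal R$, $r=C[u_1,\dots,u_n]$ w.r.t. $X=\mathcal D\cup\mathcal V$; $\mathrm{WIDP}(\mathcal R)$ likewise with $X=\mathcal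 D$. Usable rules: $f\rhd g$ if some $l\to r\in\mathcal R$ has root of $l$ equal to $f$ and $g\in\mathcal D$ occurs in $r$; $\mathcal U(t)$ = rules of $\mathcal R$ with left-hand side root $g$ such that $f\rhd^*g$ for some $f$ occurring in $t$; $\mathcal U(\mathcal Q)=\bigcup_{l\to r\in\mathcal Q}\mathcal U(r)$. The weak (innermost) dependency graph $\mathrm{WDG}(\mathcal R)$ ($\mathrm{WIDG}(\mathcal R)$) has as nodes the elements of $\mathcal P=\mathrm{WDP}(\mathcal R)$ ($\mathrm{WIDP}(\mathcal R)$) and an edge from $s\to t$ to $u\to v$ iff there are a context $C$ and substitutions $\sigma,\tau$ with $t\sigma\to^*_{\mathcal R}C[u\tau]$ (resp. $t\sigma(\xrightarrow{i}_{\mathcal R})^*C[u\tau]$). A strongly connected component (SCC) is a maximal subgraph in which every node is reachable from every other by a possibly empty path. The congruence graph has the SCCs of $\mathcal G$ as nodes and an edge from SCC $\mathcal K$ to a different SCC $\mathcal L$ iff $\mathcal G$ has an edge from a node in $\mathcal K$ to a node in $\mathcal L$; each node is identified with the set of pairs it contains. A source node is one without incoming edges; a path is a sequence $(\mathcal P_1,\dots,\mathcal P_k)$, $k\ge1$, with an edge from $\mathcal P_i$ to $\mathcal P_{i+1}$ for each $i<k$. *)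

theory Defs
  imports
    "HOL-Library.Extended_Nat"
    "HOL-Library.Countable_Set"
    "Graph_Theory.Digraph_Component"
    "Graph_Theory.Vertex_Walk"
begin

section \<open>Terms, contexts and rewriting\<close>

datatype (funs_trm: 'f, vars_trm: 'v) trm =
  is_Var: Var 'v | Fun 'f "('f, 'v) trm list"

type_synonym ('f, 'v) rule = "('f, 'v) trm \<times> ('f, 'v) trm"
type_synonym ('f, 'v) trs = "('f, 'v) rule set"

text \<open>
  The set of well-formed terms over the symbols \<open>F\<close> with arity function \<open>ar\<close>; the
  variables are all elements of the type \<open>'v\<close>.
\<close>

inductive_set terms_over :: "'f set \<Rightarrow> ('f \<Rightarrow> nat) \<Rightarrow> ('f, 'v) trm set"
  for F :: "'f set" and ar :: "'f \<Rightarrow> nat" where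
  "Var x \<in> terms_over F ar"
| "f \<in> F \<Longrightarrow> length ts = ar f \<Longrightarrow> (\<And>t. t \<in> set ts \<Longrightarrow> t \<in> terms_over F ar)
    \<Longrightarrow> Fun f ts \<in> terms_over F ar"

fun subst_apply :: "('f, 'v) trm \<Rightarrow> ('v \<Rightarrow> ('f, 'v) trm) \<Rightarrow> ('f, 'v) trm" (infixl \<open>\<cdot>\<close> 67) where
  "Var x \<cdot> \<sigma> = \<sigma> x"
| "Fun f ts \<cdot> \<sigma> = Fun f (map (\<lambda>t. t \<cdot> \<sigma>) ts)"

datatype ('f, 'v) ctxt =
  Hole | More 'f "('f, 'v) trm list" "('f, 'v) ctxt" "('f, 'v) trm list"

fun fill :: "('f, 'v) ctxt \<Rightarrow> ('f, 'v) trm \<Rightarrow> ('f, 'v) trm" (\<open>_\<langle>_\<rangle>\<close> [1000, 0] 1000) where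
  "Hole\<langle>t\<rangle> = t"
| "(More f ss C us)\<langle>t\<rangle> = Fun f (ss @ C\<langle>t\<rangle> # us)"

definition proper_subterm :: "('f, 'v) trm \<Rightarrow> ('f, 'v) trm \<Rightarrow> bool" where
  "proper_subterm u t \<longleftrightarrow> (\<exists>C. C \<noteq> Hole \<and> t = C\<langle>u\<rangle>)"

definition signature :: "'f set \<Rightarrow> ('f \<Rightarrow> nat) \<Rightarrow> bool" where
  "signature F ar \<longleftrightarrow> finite F \<and> (\<exists>f\<in>F. ar f = 0)"

definition is_trs :: "'f set \<Rightarrow> ('f \<Rightarrow> nat) \<Rightarrow> ('f, 'v) trs \<Rightarrow> bool" where
  "is_trs F ar R \<longleftrightarrow> finite R \<and>
     (\<forall>(l, r) \<in> R. l \<in> terms_over F ar \<and> r \<in> terms_over F ar \<and>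
        \<not> is_Var l \<and> vars_trm r \<subseteq> vars_trm l)"

text \<open>
  Contexts and substitutions in the rewrite relations are not restricted to well-formed terms.
  Starting from a well-formed term this makes no difference, since a context and a matching
  substitution (on the variables of the rule) only contain symbols and subterms of the
  rewritten term.
\<close>

definition rstep :: "('f, 'v) trs \<Rightarrow> ('f, 'v) trm rel" where
  "rstep R = {(C\<langle>l \<cdot> \<sigma>\<rangle>, C\<langle>r \<cdot> \<sigma>\<rangle>) | C l r \<sigma>. (l, r) \<in> R}"

definition NF :: "'a rel \<Rightarrow> 'a set" where
  "NF A = {s. \<nexists>t. (s, t) \<in> A}"

definition irstep :: "('f, 'v) trs \<Rightarrow> ('f, 'v) trm rel" where
  "irstep R = {(C\<langle>l \<cdot> \<sigma>\<rangle>, C\<langle>r \<cdot> \<sigma>\<rangle>) | C l r \<sigma>.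
     (l, r) \<in> R \<and> (\<forall>u. proper_subterm u (l \<cdot> \<sigma>) \<longrightarrow> u \<in> NF (rstep R))}"

definition terminating_from :: "'a \<Rightarrow> 'a rel \<Rightarrow> bool" where
  "terminating_from s A \<longleftrightarrow> (\<nexists>f :: nat \<Rightarrow> 'a. f 0 = s \<and> (\<forall>i. (f i, f (Suc i)) \<in> A))"

text \<open>The maximum is taken in the extended naturals: it is infinite if lengths are unbounded.\<close>

definition dh :: "'a \<Rightarrow> 'a rel \<Rightarrow> enat" where
  "dh s A = (SUP n \<in> {n. \<exists>t. (s, t) \<in> A ^^ n}. enat n)"

definition defined :: "('f, 'v) trs \<Rightarrow> 'f set" where
  "defined R = {f. \<exists>ts r. (Fun f ts, r) \<in> R}"

definition basic_terms :: "'f set \<Rightarrow> ('f \<Rightarrow> nat) \<Rightarrow> ('f, 'v) trs \<Rightarrow> ('f, 'v) trm set" where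
  "basic_terms F ar R = {Fun f ts | f ts. f \<in> defined R \<and> length ts = ar f \<and>
     set ts \<subseteq> terms_over (F - defined R) ar}"


section \<open>Weak dependency pairs\<close>

text \<open>
  The signature extended by fresh symbols: a marked symbol for every symbol, and one compound
  symbol for every rule, which is used in the dependency pair of that rule.
\<close>

datatype ('f, 'v) sym = Base 'f | Sharp 'f | Com "('f, 'v) rule"

type_synonym ('f, 'v) xtrm = "(('f, 'v) sym, 'v) trm"
type_synonym ('f, 'v) xtrs = "(('f, 'v) sym, 'v) trs"

abbreviation emb :: "('f, 'v) trm \<Rightarrow> ('f, 'v) xtrm" where
  "emb \<equiv> map_trm Base id"

definition emb_trs :: "('f, 'v) trs \<Rightarrow> ('f, 'v) xtrs" where
  "emb_trs R = {(emb l, emb r) | l r. (l, r) \<in> R}"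

fun sharp :: "('f, 'v) trm \<Rightarrow> ('f, 'v) xtrm" where
  "sharp (Var x) = Var x"
| "sharp (Fun f ts) = Fun (Sharp f) (map emb ts)"

text \<open>
  \<open>parts X t\<close> is the list \<open>[t\<^sub>1, \<dots>, t\<^sub>n]\<close> in the unique decomposition
  \<open>t = C[t\<^sub>1, \<dots>, t\<^sub>n]\<close> where \<open>C\<close> contains no element of \<open>X\<close> and every \<open>t\<^sub>i\<close> is rooted in \<open>X\<close>.
  Function symbols are tagged by \<open>Inl\<close> and variables by \<open>Inr\<close>.
\<close>

fun parts :: "('f + 'v) set \<Rightarrow> ('f, 'v) trm \<Rightarrow> ('f, 'v) trm list" where
  "parts X (Var x) = (if Inr x \<in> X then [Var x] else [])"
| "parts X (Fun f ts) = (if Inl f \<in> X then [Fun f ts] else concat (map (parts X) ts))"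

definition COM :: "('f, 'v) rule \<Rightarrow> ('f, 'v) xtrm list \<Rightarrow> ('f, 'v) xtrm" where
  "COM \<rho> ts = (if length ts = 1 then hd ts else Fun (Com \<rho>) ts)"

definition dep_pairs :: "('f + 'v) set \<Rightarrow> ('f, 'v) trs \<Rightarrow> ('f, 'v) xtrs" where
  "dep_pairs X R = {(sharp l, COM (l, r) (map sharp (parts X r))) | l r. (l, r) \<in> R}"

definition WDP :: "('f, 'v) trs \<Rightarrow> ('f, 'v) xtrs" where
  "WDP R = dep_pairs (Inl ` defined R \<union> range Inr) R"

definition WIDP :: "('f, 'v) trs \<Rightarrow> ('f, 'v) xtrs" where
  "WIDP R = dep_pairs (Inl ` defined R) R"


section \<open>Usable rules\<close>

definition depends :: "('f, 'v) trs \<Rightarrow> 'f rel" where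
  "depends R = {(f, g). g \<in> defined R \<and> (\<exists>ts r. (Fun f ts, r) \<in> R \<and> g \<in> funs_trm r)}"

definition usable :: "('f, 'v) trs \<Rightarrow> ('f, 'v) trm \<Rightarrow> ('f, 'v) trs" where
  "usable R t = {(Fun g ts, r) | g ts r. (Fun g ts, r) \<in> R \<and>
     (\<exists>f \<in> funs_trm t. (f, g) \<in> (depends R)\<^sup>*)}"

definition usable_rules :: "('f, 'v) trs \<Rightarrow> ('f, 'v) trs \<Rightarrow> ('f, 'v) trs" where
  "usable_rules R Q = (\<Union>(l, r) \<in> Q. usable R r)"


section \<open>Dependency graphs and their congruence graphs\<close>

text \<open>
  Substitutions in the definition of edges map into the terms over the original signature,
  i.e. they do not introduce marked or compound symbols.
\<close>

definition dep_graph :: "'f set \<Rightarrow> ('f \<Rightarrow> nat) \<Rightarrow> ('f, 'v) xtrm rel \<Rightarrow> ('f, 'v) xtrs \<Rightarrow>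
    (('f, 'v) xtrm \<times> ('f, 'v) xtrm,
     (('f, 'v) xtrm \<times> ('f, 'v) xtrm) \<times> (('f, 'v) xtrm \<times> ('f, 'v) xtrm)) pre_digraph" where
  "dep_graph F ar A P = \<lparr>
     verts = P,
     arcs = {((s, t), (u, v)) | s t u v. (s, t) \<in> P \<and> (u, v) \<in> P \<and>
       (\<exists>C \<sigma> \<tau>. range \<sigma> \<subseteq> terms_over F ar \<and> range \<tau> \<subseteq> terms_over F ar \<and>
          (t \<cdot> (emb \<circ> \<sigma>), C\<langle>u \<cdot> (emb \<circ> \<tau>)\<rangle>) \<in> A\<^sup>*)},
     tail = fst, head = snd \<rparr>"

definition WDG where
  "WDG F ar R = dep_graph F ar (rstep (emb_trs R)) (WDP R)"

definition WIDG where
  "WIDG F ar R = dep_graph F ar (irstep (emb_trs R)) (WIDP R)"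

definition congruence_graph :: "('a, 'b) pre_digraph \<Rightarrow> ('a set, 'a set \<times> 'a set) pre_digraph" where
  "congruence_graph G = (let N = verts ` pre_digraph.sccs G in \<lparr>
     verts = N,
     arcs = {(K, L). K \<in> N \<and> L \<in> N \<and> K \<noteq> L \<and> (\<exists>u \<in> K. \<exists>v \<in> L. (u, v) \<in> arcs_ends G)},
     tail = fst, head = snd \<rparr>)"

definition source_paths :: "('a, 'b) pre_digraph \<Rightarrow> 'a list set" where
  "source_paths H = {p. vwalk p H \<and> in_arcs H (hd p) = {}}"

text \<open>
  \<open>Path step R G s\<close> with \<open>step\<close> either \<open>rstep\<close> or \<open>irstep\<close>. The supremum over the empty set
  of paths is \<open>0\<close>; that set is empty only if \<open>G\<close> has no nodes.
\<close>

definition Path :: "(('f, 'v) xtrs \<Rightarrow> ('f, 'v) xtrm rel) \<Rightarrow> ('f, 'v) trs \<Rightarrow>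
    (('f, 'v) xtrm \<times> ('f, 'v) xtrm, 'b) pre_digraph \<Rightarrow> ('f, 'v) xtrm \<Rightarrow> enat" where
  "Path step R G s = (SUP p \<in> source_paths (congruence_graph G).
     let Q = \<Union>(set p) in dh s (step (Q \<union> usable_rules (emb_trs R) Q)))"

end

theory Submission
  imports Defs
begin

text \<open>
  A derivation from \<open>t\<close> is cut at its first root step with a rule \<open>l \<rightarrow> r\<close>. The steps before it
  only touch arguments, and can be replayed on \<open>t\<^sup>\<sharp>\<close> with usable rules; the root step is replayed
  by the dependency pair of the rule. All steps after it take place inside the instances of the
  maximal subterms \<open>u\<^sub>1, \<dots>, u\<^sub>n\<close> of \<open>r\<close>, so the remaining derivation splits into independent
  derivations from these, whose lengths add up. Each of them is treated recursively, and its next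
  root step follows an edge of the dependency graph. Thus every step belongs to a path of pairs, and
  it can be performed in the rewrite system of each path of the congruence graph that covers these
  pairs: subterms below a compound symbol that belong to other paths are simply left alone.
  Distributing the steps over the finitely many unions of paths, one of them receives at least
  a fixed fraction of all steps.
\<close>

section \<open>Paths in the congruence graph\<close>

text \<open>These are the sets \<open>Q\<close> over which \<open>Path\<close> takes its supremum.
  Being subsets of the node set, they are finite in number, which yields the constant of the
  theorem.\<close>

definition path_sets :: "('a, 'b) pre_digraph \<Rightarrow> 'a set set" where
  "path_sets G = (\<lambda>p. \<Union>(set p)) ` source_paths (congruence_graph G)"

text \<open>Remembering the last component is what allows a path to be continued along an edge
  leaving \<open>v\<close>.\<close>

definition path_sets_to :: "('a, 'b) pre_digraph \<Rightarrow> 'a \<Rightarrow> 'a set set" where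
  "path_sets_to G v =
     {\<Union>(set p) | p. p \<in> source_paths (congruence_graph G) \<and> last p = pre_digraph.scc_of G v}"

lemma path_sets_to_subset: "path_sets_to G v \<subseteq> path_sets G"
  by (auto simp: path_sets_to_def path_sets_def)

lemma vwalk_arcs_snoc:
  "p \<noteq> [] \<Longrightarrow> vwalk_arcs (p @ [v]) = vwalk_arcs p @ [(last p, v)]"
  by (induction p rule: vwalk_arcs.induct) auto

context fin_digraph
begin

lemma scc_of_eq:
  assumes "x \<in> scc_of y"
  shows "scc_of x = scc_of y"
proof -
  have "x \<rightarrow>\<^sup>* y" "y \<rightarrow>\<^sup>* x" using assms by (simp_all add: scc_of_def)
  then have "x \<rightarrow>\<^sup>* z \<longleftrightarrow> y \<rightarrow>\<^sup>* z" "z \<rightarrow>\<^sup>* x \<longleftrightarrow> z \<rightarrow>\<^sup>* y" for z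
    using reachable_trans by blast+
  then show ?thesis by (simp add: scc_of_def)
qed

lemma verts_congruence_graph: "verts (congruence_graph G) = scc_of ` verts G"
  by (simp add: congruence_graph_def sccs_verts_conv[symmetric] sccs_verts_conv_scc_of)

lemma arcs_congruence_graph:
  "arcs (congruence_graph G) = {(K, L). K \<in> scc_of ` verts G \<and> L \<in> scc_of ` verts G \<and> K \<noteq> L \<and>
     (\<exists>u \<in> K. \<exists>v \<in> L. u \<rightarrow>\<^bsub>G\<^esub> v)}"
  by (simp add: congruence_graph_def sccs_verts_conv[symmetric] sccs_verts_conv_scc_of Let_def)

lemma tail_congruence_graph [simp]: "tail (congruence_graph G) = fst"
  and head_congruence_graph [simp]: "head (congruence_graph G) = snd"
  by (simp_all add: congruence_graph_def Let_def)

lemma congruence_graph_arc: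
  assumes "u \<rightarrow>\<^bsub>G\<^esub> v" "scc_of u \<noteq> scc_of v"
  shows "(scc_of u, scc_of v) \<in> arcs_ends (congruence_graph G)"
proof -
  have "u \<in> verts G" "v \<in> verts G" using assms(1) by auto
  then have "(scc_of u, scc_of v) \<in> arcs (congruence_graph G)"
    using assms in_scc_of_self[of u] in_scc_of_self[of v] unfolding arcs_congruence_graph by blast
  then show ?thesis
    unfolding arcs_ends_def by (rule rev_image_eqI) (simp add: arc_to_ends_def)
qed

lemma source_paths_snoc:
  assumes "p \<in> source_paths (congruence_graph G)" "last p = scc_of u"
    and "u \<rightarrow>\<^bsub>G\<^esub> v" "scc_of u \<noteq> scc_of v"
  shows "p @ [scc_of v] \<in> source_paths (congruence_graph G)"
proof -
  have "v \<in> verts G" using assms(3) by auto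
  moreover have "p \<noteq> []" using assms(1) by (auto simp: source_paths_def)
  ultimately show ?thesis
    using assms(1,2) congruence_graph_arc[OF assms(3,4)]
    by (simp add: source_paths_def vwalk_def vwalk_arcs_snoc verts_congruence_graph)
qed

text \<open>
  Induction on the number of predecessors: stepping backwards to a different component loses
  at least the vertex itself.
\<close>

lemma source_path_exists:
  "v \<in> verts G \<Longrightarrow> \<exists>p \<in> source_paths (congruence_graph G). last p = scc_of v"
proof (induction "card {x. x \<rightarrow>\<^sup>* v}" arbitrary: v rule: less_induct)
  case less
  show ?case
  proof (cases "in_arcs (congruence_graph G) (scc_of v) = {}")
    case True
    then have "[scc_of v] \<in> source_paths (congruence_graph G)"
      using less.prems by (auto simp: source_paths_def vwalk_def verts_congruence_graph)
    then show ?thesis by (intro bexI[of _ "[scc_of v]"]) simp_all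
  next
    case False
    then obtain a where a: "a \<in> arcs (congruence_graph G)" "snd a = scc_of v"
      by (auto simp: in_arcs_def)
    then obtain u w x where uw: "u \<in> scc_of x" "w \<in> scc_of v" "u \<rightarrow>\<^bsub>G\<^esub> w" "scc_of x \<noteq> scc_of v"
      unfolding arcs_congruence_graph by clarsimp
    have K: "scc_of u \<noteq> scc_of v" using uw(1,4) scc_of_eq by simp
    have wv: "scc_of w = scc_of v" using uw(2) by (rule scc_of_eq)
    have "u \<in> verts G" using uw(3) by auto
    have "w \<rightarrow>\<^sup>* v" using uw(2) by (auto simp: scc_of_def)
    then have uv: "u \<rightarrow>\<^sup>* v" using uw(3) by (metis adj_reachable_trans)
    have nvu: "\<not> v \<rightarrow>\<^sup>* u"
      using uv K scc_of_eq[of u v] by (auto simp: scc_of_def)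
    have "{x. x \<rightarrow>\<^sup>* v} \<subseteq> verts G" by (auto simp: reachable_in_verts)
    then have "finite {x. x \<rightarrow>\<^sup>* v}" by (rule finite_subset) simp
    moreover have "{x. x \<rightarrow>\<^sup>* u} \<subset> {x. x \<rightarrow>\<^sup>* v}"
    proof
      show "{x. x \<rightarrow>\<^sup>* u} \<subseteq> {x. x \<rightarrow>\<^sup>* v}" using uv reachable_trans by blast
      show "{x. x \<rightarrow>\<^sup>* u} \<noteq> {x. x \<rightarrow>\<^sup>* v}" using nvu less.prems by auto
    qed
    ultimately have "card {x. x \<rightarrow>\<^sup>* u} < card {x. x \<rightarrow>\<^sup>* v}" by (rule psubset_card_mono)
    from less.hyps[OF this \<open>u \<in> verts G\<close>] obtain p
      where "p \<in> source_paths (congruence_graph G)" "last p = scc_of u" by auto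
    from source_paths_snoc[OF this uw(3)] K wv
    have "p @ [scc_of v] \<in> source_paths (congruence_graph G)" by auto
    then show ?thesis by (intro bexI[of _ "p @ [scc_of v]"]) simp_all
  qed
qed

lemma path_sets_to_nonempty: "v \<in> verts G \<Longrightarrow> path_sets_to G v \<noteq> {}"
  using source_path_exists unfolding path_sets_to_def by blast

lemma path_sets_to_mem:
  assumes "v \<in> verts G" "Q \<in> path_sets_to G v"
  shows "v \<in> Q"
proof -
  obtain p where p: "p \<in> source_paths (congruence_graph G)" "last p = scc_of v" "Q = \<Union>(set p)"
    using assms(2) by (auto simp: path_sets_to_def)
  then have "p \<noteq> []" by (auto simp: source_paths_def)
  then have "scc_of v \<in> set p" using p(2) last_in_set by metis
  then show ?thesis using p(3) in_scc_of_self[OF assms(1)] by auto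
qed

text \<open>An edge inside a component needs no extension, as the same path serves both ends. Any
  other edge yields an arc of the congruence graph, and one component is appended.\<close>

lemma path_sets_to_extend:
  assumes "Q \<in> path_sets_to G u" "u \<rightarrow>\<^bsub>G\<^esub> v"
  shows "\<exists>Q' \<in> path_sets_to G v. Q \<subseteq> Q'"
proof (cases "scc_of u = scc_of v")
  case True
  then show ?thesis using assms(1) by (auto simp: path_sets_to_def)
next
  case False
  obtain p where p: "p \<in> source_paths (congruence_graph G)" "last p = scc_of u" "Q = \<Union>(set p)"
    using assms(1) by (auto simp: path_sets_to_def)
  have "\<Union>(set (p @ [scc_of v])) \<in> path_sets_to G v"
    unfolding path_sets_to_def using source_paths_snoc[OF p(1,2) assms(2) False]
    by (intro CollectI exI[of _ "p @ [scc_of v]"]) simp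
  then show ?thesis by (rule bexI[rotated]) (auto simp: p(3))
qed

lemma path_sets_subset: "path_sets G \<subseteq> Pow (verts G)"
proof -
  have "scc_of v \<subseteq> verts G" for v by (auto simp: scc_of_def reachable_in_verts)
  then have "\<Union>(set p) \<subseteq> verts G" if "p \<in> source_paths (congruence_graph G)" for p
    using that unfolding source_paths_def vwalk_def verts_congruence_graph by blast
  then show ?thesis unfolding path_sets_def by blast
qed

lemma finite_path_sets: "finite (path_sets G)"
  using path_sets_subset finite_verts by (meson finite_Pow_iff finite_subset)

end

section \<open>Rewriting with restricted redexes\<close>

text \<open>One relation for both variants: \<open>N\<close> holds the terms allowed as proper
  subterms of a redex. \<open>UNIV\<close> gives full rewriting, the normal forms give innermost
  rewriting.\<close>

definition gstep :: "('f, 'v) trm set \<Rightarrow> ('f, 'v) trs \<Rightarrow> ('f, 'v) trm rel" where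
  "gstep N R = {(C\<langle>l \<cdot> \<sigma>\<rangle>, C\<langle>r \<cdot> \<sigma>\<rangle>) | C l r \<sigma>.
     (l, r) \<in> R \<and> (\<forall>u. proper_subterm u (l \<cdot> \<sigma>) \<longrightarrow> u \<in> N)}"

lemma rstep_eq_gstep: "rstep R = gstep UNIV R"
  by (simp add: rstep_def gstep_def)

lemma irstep_eq_gstep: "irstep R = gstep (NF (rstep R)) R"
  by (simp add: irstep_def gstep_def)

lemma gstepI:
  "(l, r) \<in> R \<Longrightarrow> (\<And>u. proper_subterm u (l \<cdot> \<sigma>) \<Longrightarrow> u \<in> N) \<Longrightarrow> (l \<cdot> \<sigma>, r \<cdot> \<sigma>) \<in> gstep N R"
  unfolding gstep_def by (intro CollectI exI[of _ Hole]) auto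

lemma fill_fill: "\<exists>E. \<forall>t. E\<langle>t\<rangle> = C\<langle>D\<langle>t\<rangle>\<rangle>"
proof (induction C)
  case Hole
  then show ?case by auto
next
  case (More f ss C us)
  then obtain E where "\<forall>t. E\<langle>t\<rangle> = C\<langle>D\<langle>t\<rangle>\<rangle>" by auto
  then show ?case by (intro exI[of _ "More f ss E us"]) auto
qed

lemma gstep_fill: "(s, t) \<in> gstep N R \<Longrightarrow> (C\<langle>s\<rangle>, C\<langle>t\<rangle>) \<in> gstep N R"
  unfolding gstep_def using fill_fill[of C] by clarsimp metis

lemma gstep_arg: "(s, t) \<in> gstep N R \<Longrightarrow> (Fun f (ss @ s # us), Fun f (ss @ t # us)) \<in> gstep N R"
  using gstep_fill[of s t N R "More f ss Hole us"] by simp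

lemma relpow_map:
  assumes "\<And>x y. (x, y) \<in> A \<Longrightarrow> (f x, f y) \<in> B"
  shows "(x, y) \<in> A ^^ n \<Longrightarrow> (f x, f y) \<in> B ^^ n"
proof (induction n arbitrary: y)
  case (Suc n)
  then show ?case using assms by auto
qed auto

lemma relpow_arg:
  "(s, t) \<in> gstep N R ^^ n \<Longrightarrow> (Fun f (ss @ s # us), Fun f (ss @ t # us)) \<in> gstep N R ^^ n"
  by (rule relpow_map[where f = "\<lambda>s. Fun f (ss @ s # us)"]) (rule gstep_arg)

text \<open>Steps strictly below the root. They survive a change of the root symbol, in particular
  its marking.\<close>

inductive_set argstep :: "('f, 'v) trm set \<Rightarrow> ('f, 'v) trs \<Rightarrow> ('f, 'v) trm rel"
  for N :: "('f, 'v) trm set" and R :: "('f, 'v) trs" where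
  "(s, t) \<in> gstep N R \<Longrightarrow> (Fun f (ss @ s # us), Fun f (ss @ t # us)) \<in> argstep N R"

lemma argstep_subset: "argstep N R \<subseteq> gstep N R"
  by (auto elim!: argstep.cases intro: gstep_arg)

lemma gstep_cases:
  assumes "(s, t) \<in> gstep N R"
  obtains (root) l r \<sigma> where "(l, r) \<in> R" "s = l \<cdot> \<sigma>" "t = r \<cdot> \<sigma>"
      "\<And>u. proper_subterm u (l \<cdot> \<sigma>) \<Longrightarrow> u \<in> N"
    | (arg) "(s, t) \<in> argstep N R"
proof -
  obtain C l r \<sigma> where *: "(l, r) \<in> R" "s = C\<langle>l \<cdot> \<sigma>\<rangle>" "t = C\<langle>r \<cdot> \<sigma>\<rangle>"
    "\<And>u. proper_subterm u (l \<cdot> \<sigma>) \<Longrightarrow> u \<in> N"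
    using assms by (auto simp: gstep_def)
  show ?thesis
  proof (cases C)
    case Hole
    then show ?thesis using * by (intro root) auto
  next
    case (More f ss D us)
    have "(D\<langle>l \<cdot> \<sigma>\<rangle>, D\<langle>r \<cdot> \<sigma>\<rangle>) \<in> gstep N R" using *(1,4) by (intro gstep_fill gstepI) auto
    then show ?thesis using * More by (intro arg) (auto intro: argstep.intros)
  qed
qed

text \<open>Arguments do not interact below a root that is never rewritten: peeling off the first
  step adds one to the count of the argument it touches.\<close>

lemma argstep_relpow_args:
  assumes "(Fun f ts, u) \<in> argstep N R ^^ n"
  shows "\<exists>ns. list_all2 (\<lambda>t n. \<exists>v. (t, v) \<in> gstep N R ^^ n) ts ns \<and> sum_list ns = n"
  using assms
proof (induction n arbitrary: ts)
  case 0
  have "list_all2 (\<lambda>t n. \<exists>v. (t, v) \<in> gstep N R ^^ n) ts (replicate (length ts) 0)"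
    by (auto simp: list_all2_conv_all_nth)
  then show ?case by (intro exI[of _ "replicate (length ts) 0"]) (simp add: sum_list_replicate)
next
  case (Suc n)
  then obtain y where y: "(Fun f ts, y) \<in> argstep N R" "(y, u) \<in> argstep N R ^^ n"
    by (blast dest: relpow_Suc_D2)
  from y(1) obtain ss s t us where st: "ts = ss @ s # us" "y = Fun f (ss @ t # us)" "(s, t) \<in> gstep N R"
    by (auto elim: argstep.cases)
  from Suc.IH[OF y(2)[unfolded st(2)]] obtain ns1 m ns2 v where
    ns: "list_all2 (\<lambda>t n. \<exists>v. (t, v) \<in> gstep N R ^^ n) ss ns1" "(t, v) \<in> gstep N R ^^ m"
    "list_all2 (\<lambda>t n. \<exists>v. (t, v) \<in> gstep N R ^^ n) us ns2" "sum_list (ns1 @ m # ns2) = n"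
    by (auto simp: list_all2_append1 list_all2_Cons1)
  have "(s, v) \<in> gstep N R ^^ Suc m" using st(3) ns(2) by (rule relpow_Suc_I2)
  then show ?case
    using ns st(1) by (intro exI[of _ "ns1 @ Suc m # ns2"])
      (auto intro!: list_all2_appendI simp del: relpow.simps)
qed

text \<open>The cut at the first root step: \<open>k\<close> argument steps, the root step itself
  (the \<open>Suc\<close>), then \<open>m\<close> steps anywhere.\<close>

lemma relpow_first_root:
  assumes "(s, u) \<in> gstep N R ^^ n"
  shows "(s, u) \<in> argstep N R ^^ n \<or>
    (\<exists>k m l r \<sigma>. n = Suc (k + m) \<and> (s, l \<cdot> \<sigma>) \<in> argstep N R ^^ k \<and> (l, r) \<in> R \<and>
       (\<forall>u. proper_subterm u (l \<cdot> \<sigma>) \<longrightarrow> u \<in> N) \<and> (r \<cdot> \<sigma>, u) \<in> gstep N R ^^ m)"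
  using assms
proof (induction n arbitrary: s)
  case 0
  then show ?case by simp
next
  case (Suc n)
  then obtain y where y: "(s, y) \<in> gstep N R" "(y, u) \<in> gstep N R ^^ n"
    by (blast dest: relpow_Suc_D2)
  from y(1) show ?case
  proof (cases rule: gstep_cases)
    case (root l r \<sigma>)
    then show ?thesis using y(2)
      by (intro disjI2 exI[of _ 0] exI[of _ n] exI[of _ l] exI[of _ r] exI[of _ \<sigma>]) auto
  next
    case arg
    from Suc.IH[OF y(2)] show ?thesis
    proof (elim disjE exE conjE)
      assume "(y, u) \<in> argstep N R ^^ n"
      with arg show ?thesis by (blast intro: relpow_Suc_I2)
    next
      fix k m l r \<sigma>
      assume "n = Suc (k + m)" "(y, l \<cdot> \<sigma>) \<in> argstep N R ^^ k" "(l, r) \<in> R"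
        "\<forall>u. proper_subterm u (l \<cdot> \<sigma>) \<longrightarrow> u \<in> N" "(r \<cdot> \<sigma>, u) \<in> gstep N R ^^ m"
      with relpow_Suc_I2[OF arg this(2)] show ?thesis
        by (intro disjI2 exI[of _ "Suc k"] exI[of _ m] exI[of _ l] exI[of _ r] exI[of _ \<sigma>]) auto
    qed
  qed
qed

section \<open>Symbols and well-formedness\<close>

lemma subst_cong: "(\<And>x. x \<in> vars_trm t \<Longrightarrow> \<sigma> x = \<tau> x) \<Longrightarrow> t \<cdot> \<sigma> = t \<cdot> \<tau>"
  by (induction t) auto

lemma funs_subst: "funs_trm (t \<cdot> \<sigma>) = funs_trm t \<union> (\<Union>x \<in> vars_trm t. funs_trm (\<sigma> x))"
  by (induction t) auto

lemma funs_fill: "funs_trm t \<subseteq> funs_trm C\<langle>t\<rangle>"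
  by (induction C) auto

lemma funs_fill_mono: "funs_trm s \<subseteq> funs_trm t \<union> B \<Longrightarrow> funs_trm C\<langle>s\<rangle> \<subseteq> funs_trm C\<langle>t\<rangle> \<union> B"
  by (induction C) auto

lemma terms_over_Fun:
  "Fun f ts \<in> terms_over F ar \<longleftrightarrow> f \<in> F \<and> length ts = ar f \<and> set ts \<subseteq> terms_over F ar"
  by (auto elim: terms_over.cases intro: terms_over.intros)

lemma terms_over_subst_vars:
  "t \<cdot> \<sigma> \<in> terms_over F ar \<Longrightarrow> x \<in> vars_trm t \<Longrightarrow> \<sigma> x \<in> terms_over F ar"
proof (induction t)
  case (Fun f ts)
  then show ?case by (auto simp: terms_over_Fun)
qed auto

lemma terms_over_substI:
  "t \<in> terms_over F ar \<Longrightarrow> (\<And>x. x \<in> vars_trm t \<Longrightarrow> \<sigma> x \<in> terms_over F ar) \<Longrightarrow> t \<cdot> \<sigma> \<in> terms_over F ar"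
proof (induction t)
  case (Fun f ts)
  then show ?case by (auto simp: terms_over_Fun)
qed auto

lemma terms_over_fill:
  "C\<langle>s\<rangle> \<in> terms_over F ar \<Longrightarrow> (s \<in> terms_over F ar \<Longrightarrow> t \<in> terms_over F ar) \<Longrightarrow>
   C\<langle>t\<rangle> \<in> terms_over F ar"
  by (induction C) (auto simp: terms_over_Fun)

lemma terms_over_funs: "t \<in> terms_over F ar \<Longrightarrow> funs_trm t \<subseteq> F"
  by (induction rule: terms_over.induct) auto

text \<open>Brings the instances of the variables of a left-hand side under the restriction on
  proper subterms of redexes.\<close>

lemma subst_var_proper_subterm:
  "x \<in> vars_trm t \<Longrightarrow> \<not> is_Var t \<Longrightarrow> proper_subterm (\<sigma> x) (t \<cdot> \<sigma>)"
proof -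
  have fill: "\<exists>C. t \<cdot> \<sigma> = C\<langle>\<sigma> x\<rangle>" if "x \<in> vars_trm t" for t
    using that
  proof (induction t)
    case (Var y)
    then show ?case by (intro exI[of _ Hole]) simp
  next
    case (Fun f ts)
    then obtain t where t: "t \<in> set ts" "x \<in> vars_trm t" by auto
    obtain ss us where "ts = ss @ t # us" using split_list[OF t(1)] by blast
    moreover obtain C where "t \<cdot> \<sigma> = C\<langle>\<sigma> x\<rangle>" using Fun.IH[OF t] by blast
    ultimately show ?case
      by (intro exI[of _ "More f (map (\<lambda>t. t \<cdot> \<sigma>) ss) C (map (\<lambda>t. t \<cdot> \<sigma>) us)"]) simp
  qed
  assume "x \<in> vars_trm t" "\<not> is_Var t"
  then obtain f ts u where t: "t = Fun f ts" "u \<in> set ts" "x \<in> vars_trm u" by (cases t) auto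
  obtain ss us where "ts = ss @ u # us" using split_list[OF t(2)] by blast
  moreover obtain C where "u \<cdot> \<sigma> = C\<langle>\<sigma> x\<rangle>" using fill[OF t(3)] by blast
  ultimately show ?thesis
    unfolding proper_subterm_def t(1)
    by (intro exI[of _ "More f (map (\<lambda>t. t \<cdot> \<sigma>) ss) C (map (\<lambda>t. t \<cdot> \<sigma>) us)"]) simp
qed

section \<open>Embedding into the extended signature\<close>

text \<open>
  Resolution may eta-expand the \<open>id\<close> inside \<open>emb\<close>; simplifying it would then leave a term
  that is no longer syntactically an instance of \<open>emb\<close>.
\<close>

declare id_apply [simp del] trm.map(1) [simp del]

lemma map_trm_id_Var [simp]: "map_trm f id (Var x) = Var x"
  by (simp add: trm.map id_apply)

lemma emb_subst: "emb (t \<cdot> \<sigma>) = emb t \<cdot> (emb \<circ> \<sigma>)"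
  by (induction t) auto

lemma sharp_subst: "\<not> is_Var t \<Longrightarrow> sharp (t \<cdot> \<sigma>) = sharp t \<cdot> (emb \<circ> \<sigma>)"
  by (cases t) (auto simp: emb_subst)

lemma emb_fill: "\<exists>D. \<forall>t. emb C\<langle>t\<rangle> = D\<langle>emb t\<rangle>"
proof (induction C)
  case Hole
  show ?case by (intro exI[of _ Hole]) simp
next
  case (More f ss C us)
  then obtain D where "\<forall>t. emb C\<langle>t\<rangle> = D\<langle>emb t\<rangle>" by blast
  then show ?case by (intro exI[of _ "More (Base f) (map emb ss) D (map emb us)"]) simp
qed

lemma map_eq_append_Cons:
  "map f ts = ss @ s # us \<Longrightarrow> \<exists>ss' s' us'. ts = ss' @ s' # us' \<and> ss = map f ss' \<and> s = f s' \<and> us = map f us'"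
  unfolding map_eq_append_conv map_eq_Cons_conv by blast

text \<open>All symbols of \<open>emb t\<close> are \<open>Base\<close> symbols, so the context
  pulls back along with its subterm. The equivalence on \<open>Hole\<close> is what transfers
  properness.\<close>

lemma emb_eq_fill: "emb t = C\<langle>u\<rangle> \<Longrightarrow> \<exists>D u'. u = emb u' \<and> t = D\<langle>u'\<rangle> \<and> (D = Hole \<longleftrightarrow> C = Hole)"
proof (induction C arbitrary: t)
  case Hole
  then show ?case by (intro exI[of _ Hole] exI[of _ t]) simp
next
  case (More f ss C us)
  then obtain g ts where t: "t = Fun g ts" and "map emb ts = ss @ C\<langle>u\<rangle> # us" by (cases t) auto
  from map_eq_append_Cons[OF this(2)] obtain ss' s' us'
    where ts: "ts = ss' @ s' # us'" "emb s' = C\<langle>u\<rangle>" by metis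
  from More.IH[OF ts(2)] obtain D u' where "u = emb u'" "s' = D\<langle>u'\<rangle>" by blast
  then show ?case unfolding t ts(1) by (intro exI[of _ "More g ss' D us'"] exI[of _ u']) simp
qed

lemma proper_subterm_emb:
  "proper_subterm u (emb t) \<Longrightarrow> \<exists>u'. u = emb u' \<and> proper_subterm u' t"
  unfolding proper_subterm_def by (metis emb_eq_fill)

text \<open>Marking changes only the root. Hence the restriction on a redex of a dependency pair
  reduces to that on the redex of the underlying rule.\<close>

lemma proper_subterm_sharp:
  assumes "proper_subterm u (sharp t)"
  shows "\<exists>u'. u = emb u' \<and> proper_subterm u' t"
proof -
  obtain C where C: "C \<noteq> Hole" "sharp t = C\<langle>u\<rangle>" using assms by (auto simp: proper_subterm_def)
  then obtain f ss D us where D: "C = More f ss D us" by (cases C) auto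
  with C obtain g ts where t: "t = Fun g ts" and "map emb ts = ss @ D\<langle>u\<rangle> # us" by (cases t) auto
  from map_eq_append_Cons[OF this(2)] obtain ss' s' us'
    where ts: "ts = ss' @ s' # us'" "emb s' = D\<langle>u\<rangle>" by metis
  from emb_eq_fill[OF ts(2)] obtain E u' where "u = emb u'" "s' = E\<langle>u'\<rangle>" by blast
  then show ?thesis unfolding t ts(1) proper_subterm_def
    by (intro exI[of _ u'] conjI exI[of _ "More g ss' E us'"]) simp_all
qed

lemma funs_emb: "funs_trm (emb t) = Base ` funs_trm t"
  by (rule trm.set_map)

section \<open>Projection back to the original signature\<close>

fun unbase :: "('f, 'v) sym \<Rightarrow> 'f" where
  "unbase (Base f) = f"
| "unbase (Sharp f) = f"
| "unbase (Com \<rho>) = undefined"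

abbreviation unemb :: "('f, 'v) xtrm \<Rightarrow> ('f, 'v) trm" where
  "unemb \<equiv> map_trm unbase id"

lemma unemb_emb [simp]: "unemb (emb t) = t"
  by (induction t) (auto simp: map_idI)

lemma unemb_subst: "unemb (t \<cdot> \<sigma>) = unemb t \<cdot> (unemb \<circ> \<sigma>)"
  by (induction t) auto

lemma unemb_fill: "\<exists>D. \<forall>t. unemb C\<langle>t\<rangle> = D\<langle>unemb t\<rangle>"
proof (induction C)
  case Hole
  show ?case by (intro exI[of _ Hole]) simp
next
  case (More f ss C us)
  then obtain D where "\<forall>t. unemb C\<langle>t\<rangle> = D\<langle>unemb t\<rangle>" by blast
  then show ?case by (intro exI[of _ "More (unbase f) (map unemb ss) D (map unemb us)"]) simp
qed

lemma parts_subset: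
  "p \<in> set (parts X t) \<Longrightarrow> \<exists>C. t = C\<langle>p\<rangle>"
proof (induction t)
  case (Var x)
  then show ?case by (intro exI[of _ Hole]) (auto split: if_splits)
next
  case (Fun f ts)
  show ?case
  proof (cases "Inl f \<in> X")
    case True
    then show ?thesis using Fun.prems by (intro exI[of _ Hole]) auto
  next
    case False
    then obtain t where t: "t \<in> set ts" "p \<in> set (parts X t)" using Fun.prems by auto
    then obtain C where "t = C\<langle>p\<rangle>" using Fun.IH by blast
    moreover obtain ss us where "ts = ss @ t # us" using split_list[OF t(1)] by blast
    ultimately show ?thesis by (intro exI[of _ "More f ss C us"]) simp
  qed
qed

lemma vars_fill: "vars_trm t \<subseteq> vars_trm C\<langle>t\<rangle>"
  by (induction C) auto

lemma terms_over_fillD: "C\<langle>t\<rangle> \<in> terms_over F ar \<Longrightarrow> t \<in> terms_over F ar"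
  by (induction C) (auto simp: terms_over_Fun)

section \<open>Compound symbols and usable rules\<close>

text \<open>Supplies the context of an edge in the dependency graph; for a singleton list
  \<open>COM\<close> adds no symbol and the context is \<open>Hole\<close>.\<close>

lemma COM_mem: "p \<in> set ps \<Longrightarrow> \<exists>C. COM \<rho> ps = C\<langle>p\<rangle>"
proof (cases "length ps = 1")
  case True
  moreover assume "p \<in> set ps"
  ultimately have "ps = [p]" by (cases ps) auto
  then show ?thesis by (intro exI[of _ Hole]) (simp add: COM_def)
next
  case False
  assume "p \<in> set ps"
  then obtain ss us where "ps = ss @ p # us" by (meson split_list)
  moreover have "COM \<rho> ps = Fun (Com \<rho>) ps" using False by (simp add: COM_def)
  ultimately have "COM \<rho> ps = (More (Com \<rho>) ss Hole us)\<langle>p\<rangle>" by simp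
  then show ?thesis by blast
qed

lemma COM_subst: "COM \<rho> ps \<cdot> \<sigma> = COM \<rho> (map (\<lambda>p. p \<cdot> \<sigma>) ps)"
  by (cases ps) (auto simp: COM_def)

text \<open>Edges demand substitutions whose values are all well-formed, whereas
  \<open>\<sigma>\<close> is controlled only on the variables of \<open>t\<close>; the other
  variables are mapped to themselves.\<close>

lemma restrict_subst:
  assumes "t \<cdot> \<sigma> \<in> terms_over F ar"
  obtains \<tau> where "range \<tau> \<subseteq> terms_over F ar" "\<And>x. x \<in> vars_trm t \<Longrightarrow> \<tau> x = \<sigma> x"
proof
  define \<tau> where "\<tau> x = (if x \<in> vars_trm t then \<sigma> x else Var x)" for x
  show "range \<tau> \<subseteq> terms_over F ar"
    using terms_over_subst_vars[OF assms] by (auto simp: \<tau>_def intro: terms_over.intros)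
  show "\<tau> x = \<sigma> x" if "x \<in> vars_trm t" for x using that by (simp add: \<tau>_def)
qed

text \<open>The root of the applied left-hand side occurs in \<open>s\<close>, so \<open>W\<close>
  need only contain the rules whose root occurs there.\<close>

lemma emb_gstep:
  assumes "(s, t) \<in> gstep N R"
    and "\<And>l r. (l, r) \<in> R \<Longrightarrow> \<not> is_Var l"
    and "\<And>f ts r. (Fun f ts, r) \<in> R \<Longrightarrow> f \<in> funs_trm s \<Longrightarrow> (emb (Fun f ts), emb r) \<in> W"
    and "\<And>s. s \<in> N \<Longrightarrow> emb s \<in> K"
  shows "(emb s, emb t) \<in> gstep K W"
proof -
  obtain C l r \<sigma> where *: "(l, r) \<in> R" "s = C\<langle>l \<cdot> \<sigma>\<rangle>" "t = C\<langle>r \<cdot> \<sigma>\<rangle>"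
    "\<And>u. proper_subterm u (l \<cdot> \<sigma>) \<Longrightarrow> u \<in> N"
    using assms(1) by (auto simp: gstep_def)
  obtain f ts where l: "l = Fun f ts" using assms(2)[OF *(1)] by (cases l) auto
  have "f \<in> funs_trm s" using funs_fill[of "l \<cdot> \<sigma>" C] by (auto simp: * l)
  then have W: "(emb l, emb r) \<in> W" using assms(3) *(1) l by blast
  obtain D where D: "\<And>t. emb C\<langle>t\<rangle> = D\<langle>emb t\<rangle>" using emb_fill by blast
  have "(emb l \<cdot> (emb \<circ> \<sigma>), emb r \<cdot> (emb \<circ> \<sigma>)) \<in> gstep K W"
    using W
  proof (rule gstepI)
    fix u assume "proper_subterm u (emb l \<cdot> (emb \<circ> \<sigma>))"
    then show "u \<in> K" using *(4) assms(4) proper_subterm_emb unfolding emb_subst[symmetric] by blast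
  qed
  from gstep_fill[OF this, of D] show ?thesis unfolding * D emb_subst .
qed

lemma sharp_argstep:
  assumes "(Fun f ts, t) \<in> argstep N R"
    and "\<And>l r. (l, r) \<in> R \<Longrightarrow> \<not> is_Var l"
    and "\<And>g us r. (Fun g us, r) \<in> R \<Longrightarrow> g \<in> (\<Union>t \<in> set ts. funs_trm t) \<Longrightarrow>
      (emb (Fun g us), emb r) \<in> W"
    and "\<And>s. s \<in> N \<Longrightarrow> emb s \<in> K"
  shows "(sharp (Fun f ts), sharp t) \<in> gstep K W"
proof -
  obtain ss s s' us where *: "(s, s') \<in> gstep N R" "ts = ss @ s # us" "t = Fun f (ss @ s' # us)"
    using assms(1) by (auto elim: argstep.cases)
  have "(emb s, emb s') \<in> gstep K W"
    using *(1) assms(2) _ assms(4) by (rule emb_gstep) (use assms(3) *(2) in auto)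
  then show ?thesis using * gstep_arg[of "emb s" "emb s'"] by simp
qed

lemma argstep_relpow_root: "(Fun f ts, t) \<in> argstep N R ^^ n \<Longrightarrow> \<exists>us. t = Fun f us"
  by (induction n arbitrary: t) (fastforce elim: argstep.cases)+

lemma gstep_rtrancl_fill: "(s, t) \<in> (gstep N R)\<^sup>* \<Longrightarrow> (C\<langle>s\<rangle>, C\<langle>t\<rangle>) \<in> (gstep N R)\<^sup>*"
  by (induction rule: rtrancl_induct) (auto intro: gstep_fill rtrancl_into_rtrancl)

section \<open>Splitting a derivation over the parts of a right-hand side\<close>

lemma list_all2_concat:
  assumes "list_all2 A xs ns"
    and "\<And>x n. x \<in> set xs \<Longrightarrow> A x n \<Longrightarrow> \<exists>ds. list_all2 B (g x) ds \<and> sum_list ds = n"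
  shows "\<exists>ds. list_all2 B (concat (map g xs)) ds \<and> sum_list ds = sum_list ns"
  using assms
proof (induction rule: list_all2_induct)
  case Nil
  then show ?case by auto
next
  case (Cons x xs n ns)
  obtain ds where "list_all2 B (g x) ds" "sum_list ds = n" using Cons.prems Cons.hyps(1) by auto
  moreover obtain ds' where "list_all2 B (concat (map g xs)) ds'" "sum_list ds' = sum_list ns"
    using Cons.IH Cons.prems by auto
  ultimately show ?case
    by (intro exI[of _ "ds @ ds'"]) (auto intro: list_all2_appendI)
qed

text \<open>No symbol above the parts is defined, so no root step happens there and the recursion
  passes to the arguments. A variable outside \<open>X\<close> is instantiated by a normal form and
  contributes no steps.\<close>

lemma parts_relpow:
  assumes "(t \<cdot> \<sigma>, u) \<in> gstep N R ^^ n"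
    and "\<And>l r. (l, r) \<in> R \<Longrightarrow> \<not> is_Var l"
    and "\<And>f. f \<in> defined R \<Longrightarrow> Inl f \<in> X"
    and "\<And>x. x \<in> vars_trm t \<Longrightarrow> Inr x \<notin> X \<Longrightarrow> \<sigma> x \<in> NF (gstep N R)"
  shows "\<exists>ds. list_all2 (\<lambda>p d. \<exists>v. (p \<cdot> \<sigma>, v) \<in> gstep N R ^^ d) (parts X t) ds \<and> sum_list ds = n"
  using assms(1,4)
proof (induction t arbitrary: n u)
  case (Var x)
  show ?case
  proof (cases "Inr x \<in> X")
    case True
    then show ?thesis using Var.prems(1) by (intro exI[of _ "[n]"]) auto
  next
    case False
    then have "\<sigma> x \<in> NF (gstep N R)" using Var.prems(2) by simp
    then have "n = 0"
      using Var.prems(1) relpow_Suc_D2[of "\<sigma> x" u]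
      by (cases n) (auto simp: NF_def simp del: relpow.simps(2))
    then show ?thesis using False by simp
  qed
next
  case (Fun f ts)
  show ?case
  proof (cases "Inl f \<in> X")
    case True
    then show ?thesis using Fun.prems(1) by (intro exI[of _ "[n]"]) auto
  next
    case False
    \<comment> \<open>Argument steps keep the root \<open>f\<close>, so a matching left-hand side
      would make \<open>f\<close> defined and put it into \<open>X\<close>.\<close>
    have "\<not> (Fun f (map (\<lambda>t. t \<cdot> \<sigma>) ts), l \<cdot> \<tau>) \<in> argstep N R ^^ k" if lr: "(l, r) \<in> R" for l r \<tau> k
    proof
      assume "(Fun f (map (\<lambda>t. t \<cdot> \<sigma>) ts), l \<cdot> \<tau>) \<in> argstep N R ^^ k"
      from argstep_relpow_root[OF this] obtain us where "l \<cdot> \<tau> = Fun f us" by blast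
      then obtain vs where "l = Fun f vs" using assms(2)[OF lr] by (cases l) auto
      then show False using lr assms(3) False by (auto simp: defined_def)
    qed
    then have "(Fun f (map (\<lambda>t. t \<cdot> \<sigma>) ts), u) \<in> argstep N R ^^ n"
      using relpow_first_root[OF Fun.prems(1)] by auto
    from argstep_relpow_args[OF this] obtain ns where
      ns: "list_all2 (\<lambda>t d. \<exists>v. (t \<cdot> \<sigma>, v) \<in> gstep N R ^^ d) ts ns" "sum_list ns = n"
      by (auto simp: list_all2_map1)
    have "\<exists>ds. list_all2 (\<lambda>p d. \<exists>v. (p \<cdot> \<sigma>, v) \<in> gstep N R ^^ d) (concat (map (parts X) ts)) ds \<and>
      sum_list ds = sum_list ns"
      using ns(1)
    proof (rule list_all2_concat)
      fix t d assume t: "t \<in> set ts" and "\<exists>v. (t \<cdot> \<sigma>, v) \<in> gstep N R ^^ d"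
      then obtain v where v: "(t \<cdot> \<sigma>, v) \<in> gstep N R ^^ d" by blast
      show "\<exists>ds. list_all2 (\<lambda>p d. \<exists>v. (p \<cdot> \<sigma>, v) \<in> gstep N R ^^ d) (parts X t) ds \<and> sum_list ds = d"
        by (rule Fun.IH[OF t v]) (use t Fun.prems(2) in auto)
    qed
    then show ?thesis using False ns(2) by simp
  qed
qed

section \<open>Finiteness and edges of dependency graphs\<close>

lemma fin_digraph_dep_graph:
  assumes "finite P"
  shows "fin_digraph (dep_graph F ar A P)"
proof
  have "arcs (dep_graph F ar A P) \<subseteq> P \<times> P" by (auto simp: dep_graph_def)
  then show "finite (arcs (dep_graph F ar A P))" using assms finite_subset by blast
qed (use assms in \<open>auto simp: dep_graph_def\<close>)

lemma dep_graph_arcI: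
  assumes "(s, t) \<in> P" "(u, v) \<in> P" "range \<sigma> \<subseteq> terms_over F ar" "range \<tau> \<subseteq> terms_over F ar"
    and "(t \<cdot> (emb \<circ> \<sigma>), C\<langle>u \<cdot> (emb \<circ> \<tau>)\<rangle>) \<in> A\<^sup>*"
  shows "((s, t), (u, v)) \<in> arcs_ends (dep_graph F ar A P)"
proof -
  have "((s, t), (u, v)) \<in> arcs (dep_graph F ar A P)" using assms by (auto simp: dep_graph_def)
  then show ?thesis unfolding arcs_ends_def
    by (rule rev_image_eqI) (simp add: arc_to_ends_def dep_graph_def)
qed

section \<open>Usable symbols and their preservation under rewriting\<close>

text \<open>The usable rules of \<open>Q\<close> are the embedded rules rooted in these symbols;
  only \<open>Base\<close> symbols are collected because embedded rules have no other roots.\<close>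

definition usable_syms :: "('f, 'v) trs \<Rightarrow> ('f, 'v) xtrs \<Rightarrow> 'f set" where
  "usable_syms R Q = {g. \<exists>(l, r) \<in> Q. \<exists>f \<in> funs_trm r. (f, Base g) \<in> (depends (emb_trs R))\<^sup>*}"

lemma usable_syms_mono: "Q \<subseteq> Q' \<Longrightarrow> usable_syms R Q \<subseteq> usable_syms R Q'"
  by (auto simp: usable_syms_def)

lemma usable_syms_rhs: "(l, r) \<in> Q \<Longrightarrow> Base g \<in> funs_trm r \<Longrightarrow> g \<in> usable_syms R Q"
  by (auto simp: usable_syms_def)

lemma usable_rulesI:
  assumes "(Fun g ts, r) \<in> R" "g \<in> usable_syms R Q"
  shows "(emb (Fun g ts), emb r) \<in> usable_rules (emb_trs R) Q"
proof -
  obtain l' r' f where *: "(l', r') \<in> Q" "f \<in> funs_trm r'" "(f, Base g) \<in> (depends (emb_trs R))\<^sup>*"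
    using assms(2) by (auto simp: usable_syms_def)
  have "(Fun (Base g) (map emb ts), emb r) \<in> emb_trs R"
    using assms(1) unfolding emb_trs_def by force
  then have "(emb (Fun g ts), emb r) \<in> usable (emb_trs R) r'"
    using *(2,3) by (auto simp: usable_def)
  then show ?thesis using *(1) by (auto simp: usable_rules_def)
qed

lemma usable_syms_closed:
  assumes "(Fun g ts, r) \<in> R" "g \<in> usable_syms R Q" "h \<in> funs_trm r" "h \<in> defined R"
  shows "h \<in> usable_syms R Q"
proof -
  have emb: "(Fun (Base f) (map emb us), emb q) \<in> emb_trs R" if "(Fun f us, q) \<in> R" for f us q
    using that unfolding emb_trs_def by force
  have "Base h \<in> defined (emb_trs R)" using assms(4) emb by (fastforce simp: defined_def)
  then have "(Base g, Base h) \<in> depends (emb_trs R)"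
    using emb[OF assms(1)] assms(3) unfolding depends_def by (auto simp: funs_emb intro!: exI)
  moreover obtain p q f where "(p, q) \<in> Q" "f \<in> funs_trm q" "(f, Base g) \<in> (depends (emb_trs R))\<^sup>*"
    using assms(2) by (auto simp: usable_syms_def)
  ultimately show ?thesis
    unfolding usable_syms_def by (blast intro: rtrancl_into_rtrancl)
qed

text \<open>A step introduces only symbols of the right-hand side, whose variables all occur on the
  left. The root of the redex is usable by assumption, so \<open>usable_syms_closed\<close> covers
  the new symbols.\<close>

lemma gstep_funs:
  assumes "(s, t) \<in> gstep N R" "is_trs F ar R" "funs_trm s \<inter> defined R \<subseteq> usable_syms R Q"
  shows "funs_trm t \<inter> defined R \<subseteq> usable_syms R Q"
proof -
  obtain C l r \<sigma> where *: "(l, r) \<in> R" "s = C\<langle>l \<cdot> \<sigma>\<rangle>" "t = C\<langle>r \<cdot> \<sigma>\<rangle>"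
    using assms(1) by (auto simp: gstep_def)
  obtain g ts where l: "l = Fun g ts" and vars: "vars_trm r \<subseteq> vars_trm l"
    using assms(2) *(1) by (cases l) (auto simp: is_trs_def)
  have "g \<in> defined R" using * l by (auto simp: defined_def)
  moreover have "g \<in> funs_trm s" using funs_fill[of "l \<cdot> \<sigma>" C] by (auto simp: * l)
  ultimately have g: "g \<in> usable_syms R Q" using assms(3) by auto
  have "funs_trm (r \<cdot> \<sigma>) \<subseteq> funs_trm (l \<cdot> \<sigma>) \<union> funs_trm r"
    using vars by (auto simp: funs_subst)
  then have "funs_trm t \<subseteq> funs_trm s \<union> funs_trm r"
    unfolding *(2,3) by (rule funs_fill_mono)
  then show ?thesis using assms(3) usable_syms_closed[OF *(1)[unfolded l] g] by auto
qed

lemma gstep_terms_over: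
  assumes "(s, t) \<in> gstep N R" "is_trs F ar R" "s \<in> terms_over F ar"
  shows "t \<in> terms_over F ar"
proof -
  obtain C l r \<sigma> where *: "(l, r) \<in> R" "s = C\<langle>l \<cdot> \<sigma>\<rangle>" "t = C\<langle>r \<cdot> \<sigma>\<rangle>"
    using assms(1) by (auto simp: gstep_def)
  have r: "r \<in> terms_over F ar" "vars_trm r \<subseteq> vars_trm l"
    using assms(2) *(1) unfolding is_trs_def by blast+
  show ?thesis unfolding *(3)
  proof (rule terms_over_fill)
    show "C\<langle>l \<cdot> \<sigma>\<rangle> \<in> terms_over F ar" using assms(3) *(2) by simp
    assume l: "l \<cdot> \<sigma> \<in> terms_over F ar"
    show "r \<cdot> \<sigma> \<in> terms_over F ar"
      by (rule terms_over_substI[OF r(1) terms_over_subst_vars[OF l]]) (use r(2) in blast)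
  qed
qed

text \<open>The root is left out because it becomes a marked symbol, and constructors are ignored
  because no rule is rooted in them.\<close>

definition args_usable :: "('f, 'v) trs \<Rightarrow> ('f, 'v) xtrs \<Rightarrow> ('f, 'v) trm list \<Rightarrow> bool" where
  "args_usable R Q ts \<longleftrightarrow> (\<Union>t \<in> set ts. funs_trm t) \<inter> defined R \<subseteq> usable_syms R Q"

lemma args_usable_mono: "args_usable R Q ts \<Longrightarrow> Q \<subseteq> Q' \<Longrightarrow> args_usable R Q' ts"
  using usable_syms_mono unfolding args_usable_def by blast

section \<open>Distributing a derivation over paths\<close>

text \<open>
  \<open>N' Q\<close> and \<open>M\<close> are the counterparts of \<open>N\<close> for the rewrite relation of a path set \<open>Q\<close> and for
  the edges of the dependency graph.
\<close>

locale dp_setting =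
  fixes F :: "'f set" and ar :: "'f \<Rightarrow> nat" and R :: "('f, 'v) trs" and X :: "('f + 'v) set"
    and N :: "('f, 'v) trm set" and N' :: "('f, 'v) xtrs \<Rightarrow> ('f, 'v) xtrm set"
    and M :: "('f, 'v) xtrm set"
  assumes trs: "is_trs F ar R"
    and X_funs: "Inl f \<in> X \<longleftrightarrow> f \<in> defined R"
    and X_vars: "Inr x \<notin> X \<Longrightarrow> N \<subseteq> NF (gstep N R)"
    and emb_M: "s \<in> N \<Longrightarrow> emb s \<in> M"
    and emb_N': "s \<in> N \<Longrightarrow> Q \<subseteq> dep_pairs X R \<Longrightarrow> emb s \<in> N' Q"
begin

abbreviation "DG \<equiv> dep_graph F ar (gstep M (emb_trs R)) (dep_pairs X R)"

definition step :: "('f, 'v) xtrs \<Rightarrow> ('f, 'v) xtrm rel" where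
  "step Q = gstep (N' Q) (Q \<union> usable_rules (emb_trs R) Q)"

text \<open>The empty set stands for the situation before any pair has been used. It admits no
  steps, so it does not affect the count.\<close>

definition family :: "('f, 'v) xtrs set" where
  "family = insert {} (path_sets DG)"

definition dpair :: "('f, 'v) trm \<Rightarrow> ('f, 'v) trm \<Rightarrow> ('f, 'v) xtrm \<times> ('f, 'v) xtrm" where
  "dpair l r = (sharp l, COM (l, r) (map sharp (parts X r)))"

lemma dpair_mem: "(l, r) \<in> R \<Longrightarrow> dpair l r \<in> dep_pairs X R"
  by (auto simp: dpair_def dep_pairs_def)

lemma lhs_not_Var: "(l, r) \<in> R \<Longrightarrow> \<not> is_Var l"
  and rhs_vars: "(l, r) \<in> R \<Longrightarrow> vars_trm r \<subseteq> vars_trm l"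
  using trs by (auto simp: is_trs_def)

lemma finite_dep_pairs: "finite (dep_pairs X R)"
proof -
  have "dep_pairs X R = (\<lambda>(l, r). dpair l r) ` R" by (auto simp: dep_pairs_def dpair_def)
  then show ?thesis using trs by (simp add: is_trs_def)
qed

lemma verts_DG: "verts DG = dep_pairs X R"
  by (simp add: dep_graph_def)

sublocale DG: fin_digraph DG
  by (rule fin_digraph_dep_graph) (rule finite_dep_pairs)

lemma finite_family: "finite family"
  using DG.finite_path_sets by (simp add: family_def)

lemma family_subset: "Q \<in> family \<Longrightarrow> Q \<subseteq> dep_pairs X R"
  using DG.path_sets_subset verts_DG unfolding family_def by auto

text \<open>
  \<open>charge Q u n\<close>: \<open>n\<close> steps can be distributed over the path sets containing \<open>Q\<close> such that each
  of these path sets admits a derivation from \<open>u\<close> of the length assigned to it.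
\<close>

definition charge :: "('f, 'v) xtrs \<Rightarrow> ('f, 'v) xtrm \<Rightarrow> nat \<Rightarrow> bool" where
  "charge Q u n \<longleftrightarrow> (\<exists>k. n \<le> sum k family \<and> (\<forall>Q' \<in> family. \<not> Q \<subseteq> Q' \<longrightarrow> k Q' = 0) \<and>
     (\<forall>Q' \<in> family. \<exists>v. (u, v) \<in> step Q' ^^ k Q'))"

lemma charge_self:
  assumes "Q \<in> family" "(u, v) \<in> step Q ^^ n"
  shows "charge Q u n"
  unfolding charge_def using assms finite_family
  by (intro exI[of _ "\<lambda>Q'. if Q' = Q then n else 0"]) auto

text \<open>The \<open>m\<close> steps form a common prefix in all members of \<open>family\<close>
  containing \<open>Q\<^sub>1\<close>; the other members carry no steps anyway.\<close>

lemma charge_prepend: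
  assumes "Q\<^sub>1 \<in> family" "Q \<subseteq> Q\<^sub>1"
    and "\<And>Q'. Q' \<in> family \<Longrightarrow> Q\<^sub>1 \<subseteq> Q' \<Longrightarrow> (u, u') \<in> step Q' ^^ m"
    and "charge Q\<^sub>1 u' n"
  shows "charge Q u (m + n)"
proof -
  obtain k where k: "n \<le> sum k family" "\<And>Q'. Q' \<in> family \<Longrightarrow> \<not> Q\<^sub>1 \<subseteq> Q' \<Longrightarrow> k Q' = 0"
    "\<And>Q'. Q' \<in> family \<Longrightarrow> \<exists>v. (u', v) \<in> step Q' ^^ k Q'"
    using assms(4) by (auto simp: charge_def)
  define k' where "k' Q' = (if Q\<^sub>1 \<subseteq> Q' then m + k Q' else 0)" for Q'
  \<comment> \<open>It suffices to count the prefix once, at \<open>Q\<^sub>1\<close>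
    itself.\<close>
  have "m + n \<le> (\<Sum>Q' \<in> family. (if Q' = Q\<^sub>1 then m else 0)) + sum k family"
    using k(1) assms(1) finite_family by simp
  also have "\<dots> = (\<Sum>Q' \<in> family. (if Q' = Q\<^sub>1 then m else 0) + k Q')"
    by (simp add: sum.distrib)
  also have "\<dots> \<le> sum k' family"
    using k(2) by (intro sum_mono) (auto simp: k'_def)
  finally have "m + n \<le> sum k' family" .
  moreover have "\<exists>v. (u, v) \<in> step Q' ^^ k' Q'" if "Q' \<in> family" for Q'
  proof (cases "Q\<^sub>1 \<subseteq> Q'")
    case True
    obtain v where "(u', v) \<in> step Q' ^^ k Q'" using k(3) \<open>Q' \<in> family\<close> by blast
    with assms(3)[OF \<open>Q' \<in> family\<close> True] have "(u, v) \<in> step Q' ^^ (m + k Q')"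
      by (auto simp: relpow_add)
    then show ?thesis using True by (auto simp: k'_def)
  qed (auto simp: k'_def)
  moreover have "k' Q' = 0" if "\<not> Q \<subseteq> Q'" for Q'
    using that assms(2) by (auto simp: k'_def)
  ultimately show ?thesis unfolding charge_def by blast
qed

text \<open>The arguments are rewritten one after the other, so the lengths add for each
  \<open>Q'\<close>. The prefix \<open>ws\<close> of arguments already treated is what lets the
  induction over the list go through.\<close>

lemma charge_Fun:
  assumes "list_all2 (charge Q) us ns"
  shows "\<exists>k. sum_list ns \<le> sum k family \<and> (\<forall>Q' \<in> family. \<not> Q \<subseteq> Q' \<longrightarrow> k Q' = 0) \<and>
    (\<forall>Q' \<in> family. \<exists>vs. \<forall>ws. (Fun f (ws @ us), Fun f (ws @ vs)) \<in> step Q' ^^ k Q')"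
  using assms
proof (induction rule: list_all2_induct)
  case Nil
  show ?case by (intro exI[of _ "\<lambda>_. 0"]) auto
next
  case (Cons u us n ns)
  obtain k\<^sub>1 where k\<^sub>1: "n \<le> sum k\<^sub>1 family" "\<forall>Q' \<in> family. \<not> Q \<subseteq> Q' \<longrightarrow> k\<^sub>1 Q' = 0"
    "\<forall>Q' \<in> family. \<exists>v. (u, v) \<in> step Q' ^^ k\<^sub>1 Q'"
    using Cons.hyps(1) unfolding charge_def by blast
  obtain k\<^sub>2 where k\<^sub>2: "sum_list ns \<le> sum k\<^sub>2 family" "\<forall>Q' \<in> family. \<not> Q \<subseteq> Q' \<longrightarrow> k\<^sub>2 Q' = 0"
    "\<forall>Q' \<in> family. \<exists>vs. \<forall>ws. (Fun f (ws @ us), Fun f (ws @ vs)) \<in> step Q' ^^ k\<^sub>2 Q'"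
    using Cons.IH by blast
  have "\<exists>vs. \<forall>ws. (Fun f (ws @ u # us), Fun f (ws @ vs)) \<in> step Q' ^^ (k\<^sub>1 Q' + k\<^sub>2 Q')"
    if Q': "Q' \<in> family" for Q'
  proof -
    obtain v where v: "(u, v) \<in> step Q' ^^ k\<^sub>1 Q'" using k\<^sub>1(3) Q' by blast
    obtain vs where vs: "\<And>ws. (Fun f (ws @ us), Fun f (ws @ vs)) \<in> step Q' ^^ k\<^sub>2 Q'"
      using k\<^sub>2(3) Q' by blast
    have "(Fun f (ws @ u # us), Fun f (ws @ v # us)) \<in> step Q' ^^ k\<^sub>1 Q'" for ws
      using v unfolding step_def by (rule relpow_arg)
    moreover have "(Fun f (ws @ v # us), Fun f (ws @ v # vs)) \<in> step Q' ^^ k\<^sub>2 Q'" for ws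
      using vs[of "ws @ [v]"] by simp
    ultimately have "(Fun f (ws @ u # us), Fun f (ws @ v # vs)) \<in> step Q' ^^ (k\<^sub>1 Q' + k\<^sub>2 Q')" for ws
      by (rule relpow_trans)
    then show ?thesis by blast
  qed
  then show ?case using k\<^sub>1(1,2) k\<^sub>2(1,2)
    by (intro exI[of _ "\<lambda>Q'. k\<^sub>1 Q' + k\<^sub>2 Q'"]) (auto simp: sum.distrib)
qed

lemma charge_COM:
  assumes "list_all2 (charge Q) us ns"
  shows "charge Q (COM \<rho> us) (sum_list ns)"
proof (cases "length us = 1")
  case True
  then obtain u where "us = [u]" by (auto simp: length_Suc_conv)
  then show ?thesis using assms by (auto simp: COM_def list_all2_Cons1)
next
  case False
  obtain k where k: "sum_list ns \<le> sum k family" "\<forall>Q' \<in> family. \<not> Q \<subseteq> Q' \<longrightarrow> k Q' = 0"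
    "\<forall>Q' \<in> family. \<exists>vs. \<forall>ws. (Fun (Com \<rho>) (ws @ us), Fun (Com \<rho>) (ws @ vs)) \<in> step Q' ^^ k Q'"
    using charge_Fun[OF assms, of "Com \<rho>"] by blast
  have "\<exists>v. (Fun (Com \<rho>) us, v) \<in> step Q' ^^ k Q'" if Q': "Q' \<in> family" for Q'
  proof -
    obtain vs where "\<forall>ws. (Fun (Com \<rho>) (ws @ us), Fun (Com \<rho>) (ws @ vs)) \<in> step Q' ^^ k Q'"
      using k(3) Q' by blast
    from this[rule_format, of "[]"] show ?thesis by auto
  qed
  moreover have "COM \<rho> us = Fun (Com \<rho>) us" using False by (simp add: COM_def)
  ultimately show ?thesis using k(1,2) unfolding charge_def by auto
qed

section \<open>Replaying derivations on embedded and marked terms\<close>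

text \<open>Needed for parts that are variables: their instances carry no mark, so whole
  derivations, root steps included, are replayed by usable rules.\<close>

lemma step_emb:
  assumes "(s, t) \<in> gstep N R ^^ n" "funs_trm s \<inter> defined R \<subseteq> usable_syms R Q" "Q \<in> family"
  shows "(emb s, emb t) \<in> step Q ^^ n"
  using assms(1)
proof (induction n arbitrary: t)
  case 0
  then show ?case by simp
next
  case (Suc n)
  then obtain y where y: "(s, y) \<in> gstep N R ^^ n" "(y, t) \<in> gstep N R" by auto
  have "funs_trm y \<inter> defined R \<subseteq> usable_syms R Q"
    using y(1)
  proof (induction n arbitrary: y)
    case 0
    then show ?case using assms(2) by simp
  next
    case (Suc n)
    then show ?case using gstep_funs[OF _ trs] by (meson relpow_Suc_E)
  qed
  note y_usable = this
  have "(emb y, emb t) \<in> step Q"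
    unfolding step_def using y(2) lhs_not_Var
  proof (rule emb_gstep)
    fix g vs r assume *: "(Fun g vs, r) \<in> R" "g \<in> funs_trm y"
    then have "g \<in> usable_syms R Q"
      using y_usable by (auto simp: defined_def)
    then show "(emb (Fun g vs), emb r) \<in> Q \<union> usable_rules (emb_trs R) Q"
      using usable_rulesI[OF *(1)] by blast
  qed (use emb_N' family_subset[OF assms(3)] in auto)
  with Suc.IH[OF y(1)] show ?case by auto
qed

lemma argstep_relpow_terms_over:
  "(s, t) \<in> argstep N R ^^ n \<Longrightarrow> s \<in> terms_over F ar \<Longrightarrow> t \<in> terms_over F ar"
proof (induction n arbitrary: t)
  case (Suc n)
  then show ?case using gstep_terms_over[OF _ trs] argstep_subset by (meson relpow_Suc_E subsetD)
qed simp

lemma argstep_relpow_usable: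
  assumes "(Fun f ts, t) \<in> argstep N R ^^ n" "args_usable R Q ts"
  shows "\<exists>us. t = Fun f us \<and> args_usable R Q us"
  using assms(1)
proof (induction n arbitrary: t)
  case 0
  then show ?case using assms(2) by auto
next
  case (Suc n)
  then obtain us where us: "args_usable R Q us" "(Fun f us, t) \<in> argstep N R"
    by auto
  then obtain ss s s' vs where *: "(s, s') \<in> gstep N R" "us = ss @ s # vs" "t = Fun f (ss @ s' # vs)"
    by (auto elim: argstep.cases)
  have "args_usable R Q (ss @ s' # vs)"
    using us(1) gstep_funs[OF *(1) trs, of Q] unfolding args_usable_def *(2) by auto
  then show ?case using *(3) by auto
qed

text \<open>Only arguments are rewritten, so the mark at the root is harmless, and every applied
  rule is usable because \<open>args_usable\<close> is invariant.\<close>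

lemma step_sharp:
  assumes "(Fun f ts, t) \<in> argstep N R ^^ n" "args_usable R Q ts" "Q \<in> family"
  shows "(sharp (Fun f ts), sharp t) \<in> step Q ^^ n"
  using assms(1)
proof (induction n arbitrary: t)
  case 0
  then show ?case by simp
next
  case (Suc n)
  then obtain y where y: "(Fun f ts, y) \<in> argstep N R ^^ n" "(y, t) \<in> argstep N R" by auto
  obtain us where us: "y = Fun f us" "args_usable R Q us"
    using argstep_relpow_usable[OF y(1) assms(2)] by blast
  have "(sharp y, sharp t) \<in> step Q"
    unfolding step_def us(1)
    using y(2)[unfolded us(1)] lhs_not_Var
  proof (rule sharp_argstep)
    fix g vs r assume *: "(Fun g vs, r) \<in> R" "g \<in> (\<Union>t \<in> set us. funs_trm t)"
    then have "g \<in> usable_syms R Q" using us(2) by (auto simp: args_usable_def defined_def)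
    then show "(emb (Fun g vs), emb r) \<in> Q \<union> usable_rules (emb_trs R) Q"
      using usable_rulesI[OF *(1)] by blast
  qed (use emb_N' family_subset[OF assms(3)] in auto)
  with Suc.IH[OF y(1)] show ?case by auto
qed

text \<open>Here all of \<open>R\<close> is available, as edges of the dependency graph are not
  confined to usable rules.\<close>

lemma edge_step_sharp:
  assumes "(Fun f ts, t) \<in> argstep N R ^^ n"
  shows "(sharp (Fun f ts), sharp t) \<in> (gstep M (emb_trs R))\<^sup>*"
  using assms
proof (induction n arbitrary: t)
  case 0
  then show ?case by simp
next
  case (Suc n)
  then obtain us where us: "(Fun f ts, Fun f us) \<in> argstep N R ^^ n" "(Fun f us, t) \<in> argstep N R"
    using argstep_relpow_root by (metis relpow_Suc_E)
  have "(sharp (Fun f us), sharp t) \<in> gstep M (emb_trs R)"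
    using us(2) lhs_not_Var _ emb_M by (rule sharp_argstep) (auto simp: emb_trs_def simp del: trm.map)
  with Suc.IH[OF us(1)] show ?case by (rule rtrancl_into_rtrancl)
qed

text \<open>
  Every dependency pair that can be applied next at \<open>s\<^sup>\<sharp>\<close> lies on an extension of the path
  behind \<open>Q\<close>.
\<close>

definition extendable :: "('f, 'v) xtrs \<Rightarrow> ('f, 'v) trm \<Rightarrow> bool" where
  "extendable Q s \<longleftrightarrow> (\<forall>l r \<tau> n. (l, r) \<in> R \<longrightarrow> (s, l \<cdot> \<tau>) \<in> argstep N R ^^ n \<longrightarrow>
     (\<exists>Q' \<in> path_sets_to DG (dpair l r). Q \<subseteq> Q'))"

text \<open>The argument steps from the instance of a part to the next left-hand side, marked and
  placed inside the compound term, are the reachability that an edge asks for. The path extends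
  along this edge.\<close>

lemma extendable_part:
  assumes "(l, r) \<in> R" "Q \<in> path_sets_to DG (dpair l r)" "Fun g us \<in> set (parts X r)"
    and "range \<tau> \<subseteq> terms_over F ar"
  shows "extendable Q (Fun g us \<cdot> \<tau>)"
  unfolding extendable_def
proof (intro allI impI)
  fix l' r' \<sigma> n
  assume *: "(l', r') \<in> R" "(Fun g us \<cdot> \<tau>, l' \<cdot> \<sigma>) \<in> argstep N R ^^ n"
  have r: "r \<in> terms_over F ar" using trs assms(1) by (auto simp: is_trs_def)
  obtain C where C: "r = C\<langle>Fun g us\<rangle>" using parts_subset[OF assms(3)] by blast
  have "Fun g us \<cdot> \<tau> \<in> terms_over F ar"
    using assms(4) terms_over_fillD[OF r[unfolded C]] by (intro terms_over_substI) auto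
  then have "l' \<cdot> \<sigma> \<in> terms_over F ar"
    by (rule argstep_relpow_terms_over[OF *(2)])
  then obtain \<sigma>' where \<sigma>': "range \<sigma>' \<subseteq> terms_over F ar" "\<And>x. x \<in> vars_trm l' \<Longrightarrow> \<sigma>' x = \<sigma> x"
    using restrict_subst by blast
  then have l': "l' \<cdot> \<sigma> = l' \<cdot> \<sigma>'" by (intro subst_cong) auto
  let ?q = "COM (l, r) (map sharp (parts X r))"
  have "sharp (Fun g us) \<cdot> (emb \<circ> \<tau>) \<in> set (map (\<lambda>p. p \<cdot> (emb \<circ> \<tau>)) (map sharp (parts X r)))"
    using assms(3) by force
  then obtain D where D: "?q \<cdot> (emb \<circ> \<tau>) = D\<langle>sharp (Fun g us) \<cdot> (emb \<circ> \<tau>)\<rangle>"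
    using COM_mem unfolding COM_subst by blast
  have "(sharp (Fun g us \<cdot> \<tau>), sharp (l' \<cdot> \<sigma>')) \<in> (gstep M (emb_trs R))\<^sup>*"
    using edge_step_sharp *(2) unfolding l' subst_apply.simps .
  then have "(sharp (Fun g us) \<cdot> (emb \<circ> \<tau>), sharp l' \<cdot> (emb \<circ> \<sigma>')) \<in> (gstep M (emb_trs R))\<^sup>*"
    using lhs_not_Var[OF *(1)] by (simp only: sharp_subst trm.disc not_False_eq_True)
  then have "(D\<langle>sharp (Fun g us) \<cdot> (emb \<circ> \<tau>)\<rangle>, D\<langle>sharp l' \<cdot> (emb \<circ> \<sigma>')\<rangle>) \<in> (gstep M (emb_trs R))\<^sup>*"
    by (rule gstep_rtrancl_fill)
  then have "(dpair l r, dpair l' r') \<in> arcs_ends DG"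
    using dpair_mem[OF assms(1)] dpair_mem[OF *(1)] assms(4) \<sigma>'(1) D[symmetric]
    unfolding dpair_def by (intro dep_graph_arcI) auto
  then show "\<exists>Q' \<in> path_sets_to DG (dpair l' r'). Q \<subseteq> Q'"
    using DG.path_sets_to_extend[OF assms(2)] by blast
qed

text \<open>Strong induction on \<open>n\<close>. Without a root step everything is charged to
  \<open>Q\<close>. Otherwise the argument steps and the pair are a common prefix, and the remaining
  \<open>m < n\<close> steps are distributed part by part.\<close>

lemma charge_basic:
  assumes "(Fun f ts, u) \<in> gstep N R ^^ n" "Fun f ts \<in> terms_over F ar"
    and "args_usable R Q ts" "Q \<in> family" "extendable Q (Fun f ts)"
  shows "charge Q (sharp (Fun f ts)) n"
  using assms
proof (induction n arbitrary: f ts u Q rule: less_induct)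
  case (less n)
  consider "(Fun f ts, u) \<in> argstep N R ^^ n"
    | k m l r \<sigma> where "n = Suc (k + m)" "(Fun f ts, l \<cdot> \<sigma>) \<in> argstep N R ^^ k" "(l, r) \<in> R"
      "\<And>u. proper_subterm u (l \<cdot> \<sigma>) \<Longrightarrow> u \<in> N" "(r \<cdot> \<sigma>, u) \<in> gstep N R ^^ m"
    using relpow_first_root[OF less.prems(1)] by blast
  then show ?case
  proof cases
    case 1
    show ?thesis by (rule charge_self[OF less.prems(4) step_sharp[OF 1 less.prems(3,4)]])
  next
    case (2 k m l r \<sigma>)
    obtain \<tau> where \<tau>: "range \<tau> \<subseteq> terms_over F ar" "\<And>x. x \<in> vars_trm l \<Longrightarrow> \<tau> x = \<sigma> x"
      using restrict_subst argstep_relpow_terms_over[OF 2(2) less.prems(2)] by blast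
    have l: "l \<cdot> \<sigma> = l \<cdot> \<tau>" and r: "r \<cdot> \<sigma> = r \<cdot> \<tau>"
      using \<tau>(2) rhs_vars[OF 2(3)] by (auto intro!: subst_cong)
    note nonvar = lhs_not_Var[OF 2(3)]
    \<comment> \<open>A path to the component of the pair used at the root; from here on only sets
      containing \<open>Q\<^sub>1\<close> are charged.\<close>
    obtain Q\<^sub>1 where Q\<^sub>1: "Q\<^sub>1 \<in> path_sets_to DG (dpair l r)" "Q \<subseteq> Q\<^sub>1"
      using less.prems(5) 2(2,3) unfolding extendable_def by blast
    have Q\<^sub>1_family: "Q\<^sub>1 \<in> family"
      using subsetD[OF path_sets_to_subset Q\<^sub>1(1)] by (simp add: family_def)
    have pair: "dpair l r \<in> Q\<^sub>1"
      using DG.path_sets_to_mem[OF _ Q\<^sub>1(1)] dpair_mem[OF 2(3)] by (simp add: verts_DG)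
    define q where "q = COM (l, r) (map sharp (parts X r))"
    \<comment> \<open>The common prefix of \<open>k\<close> argument steps and one step by the pair;
      it exists in every such \<open>Q'\<close> because usable symbols only grow with the
      set.\<close>
    have before: "(sharp (Fun f ts), q \<cdot> (emb \<circ> \<tau>)) \<in> step Q' ^^ Suc k"
      if Q': "Q' \<in> family" "Q\<^sub>1 \<subseteq> Q'" for Q'
    proof -
      have "args_usable R Q' ts" using less.prems(3) Q\<^sub>1(2) Q'(2) args_usable_mono by blast
      then have "(sharp (Fun f ts), sharp (l \<cdot> \<tau>)) \<in> step Q' ^^ k"
        using step_sharp[OF 2(2)] Q'(1) l by simp
      moreover have "(sharp l \<cdot> (emb \<circ> \<tau>), q \<cdot> (emb \<circ> \<tau>)) \<in> step Q'"
        unfolding step_def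
      proof (rule gstepI)
        show "(sharp l, q) \<in> Q' \<union> usable_rules (emb_trs R) Q'"
          using pair Q'(2) by (auto simp: dpair_def q_def)
        fix u assume "proper_subterm u (sharp l \<cdot> (emb \<circ> \<tau>))"
        then obtain u' where "u = emb u'" "proper_subterm u' (l \<cdot> \<tau>)"
          using proper_subterm_sharp unfolding sharp_subst[OF nonvar, symmetric] by blast
        then show "u \<in> N' Q'" using 2(4) emb_N' family_subset[OF Q'(1)] l by auto
      qed
      ultimately show ?thesis by (auto simp: sharp_subst[OF nonvar])
    qed
    \<comment> \<open>Instances of variables lie strictly inside the redex, hence in
      \<open>N\<close>, which for variables outside \<open>X\<close> consists of normal
      forms.\<close>
    have N_vars: "\<tau> x \<in> NF (gstep N R)" if "x \<in> vars_trm r" "Inr x \<notin> X" for x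
      using subst_var_proper_subterm[of x l \<tau>] nonvar rhs_vars[OF 2(3)] that 2(4) X_vars l by auto
    have "\<exists>ds. list_all2 (\<lambda>p d. \<exists>v. (p \<cdot> \<tau>, v) \<in> gstep N R ^^ d) (parts X r) ds \<and> sum_list ds = m"
      by (rule parts_relpow[OF 2(5)[unfolded r]]) (use lhs_not_Var X_funs N_vars in blast)+
    then obtain ds where ds: "sum_list ds = m"
      "list_all2 (\<lambda>p d. \<exists>v. (p \<cdot> \<tau>, v) \<in> gstep N R ^^ d) (parts X r) ds"
      by blast
    obtain ts' where ts': "l \<cdot> \<tau> = Fun f ts'" "args_usable R Q ts'"
      using argstep_relpow_usable[OF 2(2) less.prems(3)] l by auto
    \<comment> \<open>Such an instance occurs inside an argument of \<open>l \<cdot> \<tau>\<close>,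
      where all defined symbols are usable.\<close>
    have vars_usable: "funs_trm (\<tau> x) \<inter> defined R \<subseteq> usable_syms R Q\<^sub>1" if x: "x \<in> vars_trm l" for x
    proof -
      obtain ls where ls: "l = Fun f ls" "ts' = map (\<lambda>t. t \<cdot> \<tau>) ls"
        using ts'(1) nonvar by (cases l) auto
      then obtain a where a: "a \<in> set ls" "x \<in> vars_trm a" using x by auto
      then have "funs_trm (\<tau> x) \<subseteq> (\<Union>t \<in> set ts'. funs_trm t)"
        unfolding ls(2) by (auto simp: funs_subst)
      then show ?thesis
        using args_usable_mono[OF ts'(2) Q\<^sub>1(2)] unfolding args_usable_def by blast
    qed
    have "charge Q\<^sub>1 (sharp p \<cdot> (emb \<circ> \<tau>)) d"
      if p: "p \<in> set (parts X r)" and d: "d \<in> set ds" "(p \<cdot> \<tau>, v) \<in> gstep N R ^^ d" for p d v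
    proof -
      obtain C where C: "r = C\<langle>p\<rangle>" using parts_subset[OF p] by blast
      have p_vars: "vars_trm p \<subseteq> vars_trm l" using vars_fill[of p C] C rhs_vars[OF 2(3)] by blast
      have "d < n" using member_le_sum_list[OF d(1)] ds(1) 2(1) by simp
      show ?thesis
      proof (cases p)
        \<comment> \<open>\<open>sharp\<close> leaves the variable unmarked, so no further pair is
          involved and all \<open>d\<close> steps are charged to \<open>Q\<^sub>1\<close>.\<close>
        case (Var x)
        then have "(emb (\<tau> x), emb v) \<in> step Q\<^sub>1 ^^ d"
          using step_emb[OF _ vars_usable Q\<^sub>1_family] d(2) p_vars by auto
        then show ?thesis using Var Q\<^sub>1_family by (auto intro: charge_self)
      next
        case (Fun g us)
        have "charge Q\<^sub>1 (sharp (Fun g (map (\<lambda>t. t \<cdot> \<tau>) us))) d"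
        proof (rule less.IH[OF \<open>d < n\<close> _ _ _ Q\<^sub>1_family])
          show "(Fun g (map (\<lambda>t. t \<cdot> \<tau>) us), v) \<in> gstep N R ^^ d" using d(2) Fun by simp
          have "p \<in> terms_over F ar"
            using trs 2(3) C terms_over_fillD by (fastforce simp: is_trs_def)
          then have "p \<cdot> \<tau> \<in> terms_over F ar" using \<tau>(1) by (intro terms_over_substI) auto
          then show "Fun g (map (\<lambda>t. t \<cdot> \<tau>) us) \<in> terms_over F ar" using Fun by simp
          show "extendable Q\<^sub>1 (Fun g (map (\<lambda>t. t \<cdot> \<tau>) us))"
            using extendable_part[OF 2(3) Q\<^sub>1(1) _ \<tau>(1)] p Fun by simp
          \<comment> \<open>A defined symbol below the root of the part stems either from the
            right-hand side of the pair, where it occurs unmarked, or from the instance of a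
            variable.\<close>
          have "h \<in> usable_syms R Q\<^sub>1" if h: "t \<in> set us" "h \<in> funs_trm (t \<cdot> \<tau>)" "h \<in> defined R" for t h
          proof (cases "h \<in> funs_trm t")
            case True
            have h': "Base h \<in> funs_trm (sharp p)" using True h(1) Fun by (auto simp: funs_emb)
            obtain D where D: "q = D\<langle>sharp p\<rangle>"
              using COM_mem[of "sharp p" "map sharp (parts X r)"] p unfolding q_def by auto
            have "Base h \<in> funs_trm q" unfolding D by (rule subsetD[OF funs_fill h'])
            moreover have "(sharp l, q) \<in> Q\<^sub>1" using pair by (simp add: dpair_def q_def)
            ultimately show ?thesis by (rule usable_syms_rhs[rotated])
          next
            case False
            then obtain x where x: "x \<in> vars_trm t" "h \<in> funs_trm (\<tau> x)"
              using h(2) by (auto simp: funs_subst)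
            then have "x \<in> vars_trm l" using p_vars h(1) Fun by auto
            then show ?thesis using vars_usable[of x] x(2) h(3) by blast
          qed
          then show "args_usable R Q\<^sub>1 (map (\<lambda>t. t \<cdot> \<tau>) us)" by (auto simp: args_usable_def)
        qed
        moreover have "sharp (Fun g (map (\<lambda>t. t \<cdot> \<tau>) us)) = sharp p \<cdot> (emb \<circ> \<tau>)"
          using sharp_subst[of p \<tau>] Fun by (simp del: sharp.simps)
        ultimately show ?thesis by (simp only:)
      qed
    qed
    then have "list_all2 (charge Q\<^sub>1) (map (\<lambda>p. sharp p \<cdot> (emb \<circ> \<tau>)) (parts X r)) ds"
      using ds(2) unfolding list_all2_map1
      by (elim list.rel_mono_strong) blast
    from charge_COM[OF this, of "(l, r)"] have "charge Q\<^sub>1 (q \<cdot> (emb \<circ> \<tau>)) m"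
      by (simp add: q_def COM_subst ds(1) comp_def)
    from charge_prepend[OF Q\<^sub>1_family Q\<^sub>1(2) before this] show ?thesis using 2(1) by simp
  qed
qed

text \<open>Arguments of a basic term contain no defined symbol and every pair ends some source
  path, so charging can start from the empty set. The sum over the path sets is at most their number
  times the supremum.\<close>

lemma basic_bound:
  assumes "t \<in> basic_terms F ar R"
  shows "dh t (gstep N R) \<le> enat (card (path_sets DG)) * (SUP Q \<in> path_sets DG. dh (sharp t) (step Q))"
    (is "_ \<le> _ * ?b")
  unfolding dh_def[of t]
proof (rule SUP_least)
  fix n assume "n \<in> {n. \<exists>u. (t, u) \<in> gstep N R ^^ n}"
  then obtain u where u: "(t, u) \<in> gstep N R ^^ n" by blast
  obtain f ts where t: "t = Fun f ts" "f \<in> defined R" "length ts = ar f"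
    "set ts \<subseteq> terms_over (F - defined R) ar"
    using assms by (auto simp: basic_terms_def)
  have "f \<in> F" using t(2) trs by (fastforce simp: defined_def is_trs_def terms_over_Fun)
  moreover have mono: "s \<in> terms_over F ar" if "s \<in> terms_over (F - defined R) ar" for s :: "('f, 'v) trm"
    using that by induction (auto intro: terms_over.intros)
  ultimately have wf: "Fun f ts \<in> terms_over F ar" using t by (auto simp: terms_over_Fun)
  have "args_usable R {} ts"
    using terms_over_funs t(4) unfolding args_usable_def by blast
  moreover have "extendable {} (Fun f ts)"
    using DG.path_sets_to_nonempty dpair_mem unfolding extendable_def verts_DG by blast
  ultimately have "charge {} (sharp t) n"
    using charge_basic u wf unfolding t(1) family_def by blast
  then obtain k where k: "n \<le> sum k family" "\<And>Q. Q \<in> family \<Longrightarrow> \<exists>v. (sharp t, v) \<in> step Q ^^ k Q"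
    unfolding charge_def by blast
  \<comment> \<open>Without pairs there are no usable rules either, so the empty set receives no
    steps and drops out of the sum.\<close>
  have "step {} = {}" by (auto simp: step_def gstep_def usable_rules_def)
  then have "k {} = 0" using k(2)[of "{}"] by (cases "k {}") (auto simp: family_def)
  then have "sum k family = sum k (path_sets DG)"
    using DG.finite_path_sets by (auto simp: family_def sum.insert_if)
  then have "enat n \<le> (\<Sum>Q \<in> path_sets DG. enat (k Q))"
    using k(1) by (simp flip: of_nat_eq_enat of_nat_sum)
  also have "\<dots> \<le> of_nat (card (path_sets DG)) * ?b"
  proof (rule sum_bounded_above)
    fix Q assume Q: "Q \<in> path_sets DG"
    have "enat (k Q) \<le> dh (sharp t) (step Q)"
      using k(2)[of Q] Q unfolding dh_def family_def by (intro SUP_upper) auto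
    also have "\<dots> \<le> ?b" using Q by (rule SUP_upper)
    finally show "enat (k Q) \<le> ?b" .
  qed
  finally show "enat n \<le> enat (card (path_sets DG)) * ?b" by (simp add: of_nat_eq_enat)
qed

end

section \<open>Normal forms of embedded terms and the two instances\<close>

lemma unemb_emb_trs: "(l, r) \<in> emb_trs R \<Longrightarrow> (unemb l, unemb r) \<in> R"
  by (auto simp: emb_trs_def)

text \<open>Left-hand sides of pairs have a marked root, which embedded terms lack. A step by a rule
  of \<open>W\<close> would project under \<open>unemb\<close> to a step of \<open>R\<close> from
  \<open>s\<close>.\<close>

lemma NF_emb:
  assumes "s \<in> NF (rstep R)" "is_trs F ar R" "Q \<subseteq> dep_pairs X R"
    and "W \<subseteq> emb_trs R"
  shows "emb s \<in> NF (rstep (Q \<union> W))"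
  unfolding NF_def
proof (intro CollectI notI, elim exE)
  fix t assume "(emb s, t) \<in> rstep (Q \<union> W)"
  then obtain C l r \<sigma> where *: "(l, r) \<in> Q \<union> W" "emb s = C\<langle>l \<cdot> \<sigma>\<rangle>" by (auto simp: rstep_def)
  have "(l, r) \<notin> Q"
  proof
    assume "(l, r) \<in> Q"
    then obtain l' r' where "l = sharp l'" "(l', r') \<in> R" using assms(3) by (auto simp: dep_pairs_def)
    then obtain f ts where "l = Fun (Sharp f) ts" using assms(2) by (cases l') (auto simp: is_trs_def)
    then have "Sharp f \<in> funs_trm (emb s)" using funs_fill[of "l \<cdot> \<sigma>" C] * by auto
    then show False by (auto simp: funs_emb)
  qed
  then have "(unemb l, unemb r) \<in> R" using *(1) assms(4) unemb_emb_trs by blast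
  moreover obtain D where "unemb C\<langle>l \<cdot> \<sigma>\<rangle> = D\<langle>unemb (l \<cdot> \<sigma>)\<rangle>" using unemb_fill by blast
  then have "s = D\<langle>unemb l \<cdot> (unemb \<circ> \<sigma>)\<rangle>" by (simp flip: *(2) add: unemb_subst)
  ultimately have "(s, D\<langle>unemb r \<cdot> (unemb \<circ> \<sigma>)\<rangle>) \<in> rstep R" by (auto simp: rstep_def)
  then show False using assms(1) by (auto simp: NF_def)
qed

lemma gstep_subset_rstep: "gstep N R \<subseteq> rstep R"
  unfolding gstep_def rstep_def by blast

lemma usable_rules_subset: "usable_rules R Q \<subseteq> R"
  by (auto simp: usable_rules_def usable_def)

theorem theorem67:
  fixes F :: "'f set" and ar :: "'f \<Rightarrow> nat" and R :: "('f, 'v) trs"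
  assumes "infinite (UNIV :: 'v set)" and "countable (UNIV :: 'v set)"
    and "signature F ar"
    and "is_trs F ar R"
  shows "(\<exists>c :: nat. \<forall>t \<in> basic_terms F ar R. terminating_from t (rstep R) \<longrightarrow>
            dh t (rstep R) \<le> enat c * Path rstep R (WDG F ar R) (sharp t))
       \<and> (\<exists>c :: nat. \<forall>t \<in> basic_terms F ar R. terminating_from t (irstep R) \<longrightarrow>
            dh t (irstep R) \<le> enat c * Path irstep R (WIDG F ar R) (sharp t))"
proof
  \<comment> \<open>Full rewriting restricts no redex, and all variables count as parts.\<close>
  interpret full: dp_setting F ar R "Inl ` defined R \<union> range Inr" UNIV "\<lambda>_. UNIV" UNIV
    using assms(4) by unfold_locales auto
  have eq: "Path rstep R (WDG F ar R) s = (SUP Q \<in> path_sets full.DG. dh s (full.step Q))" for s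
    by (simp only: Path_def full.step_def WDG_def WDP_def rstep_eq_gstep path_sets_def Let_def image_image)
  show "\<exists>c :: nat. \<forall>t \<in> basic_terms F ar R. terminating_from t (rstep R) \<longrightarrow>
      dh t (rstep R) \<le> enat c * Path rstep R (WDG F ar R) (sharp t)"
  proof (intro exI ballI impI)
    fix t assume "t \<in> basic_terms F ar R"
    from full.basic_bound[OF this]
    \<comment> \<open>The constant is the number of path sets, which does not depend on
      \<open>t\<close>.\<close>
    show "dh t (rstep R) \<le> enat (card (path_sets full.DG)) * Path rstep R (WDG F ar R) (sharp t)"
      unfolding eq rstep_eq_gstep[of R] .
  qed
next
  \<comment> \<open>Each relation restricts redexes by its own normal forms: those of
    \<open>R\<close> for the given derivation, those of a path set with its usable rules for the
    replay, those of embedded \<open>R\<close> for edges.\<close>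
  interpret inner: dp_setting F ar R "Inl ` defined R" "NF (rstep R)"
    "\<lambda>Q. NF (rstep (Q \<union> usable_rules (emb_trs R) Q))" "NF (rstep (emb_trs R))"
  proof
    show "NF (rstep R) \<subseteq> NF (gstep (NF (rstep R)) R)"
      using gstep_subset_rstep by (auto simp: NF_def)
    show "emb s \<in> NF (rstep (emb_trs R))" if "s \<in> NF (rstep R)" for s
      using NF_emb[OF that assms(4), of "{}" _ "emb_trs R"] by simp
    show "emb s \<in> NF (rstep (Q \<union> usable_rules (emb_trs R) Q))"
      if "s \<in> NF (rstep R)" "Q \<subseteq> dep_pairs (Inl ` defined R) R" for s Q
      using that assms(4) usable_rules_subset by (blast intro: NF_emb)
  qed (use assms(4) in auto)
  have eq: "Path irstep R (WIDG F ar R) s = (SUP Q \<in> path_sets inner.DG. dh s (inner.step Q))" for s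
    by (simp only: Path_def inner.step_def WIDG_def WIDP_def irstep_eq_gstep path_sets_def Let_def image_image)
  show "\<exists>c :: nat. \<forall>t \<in> basic_terms F ar R. terminating_from t (irstep R) \<longrightarrow>
      dh t (irstep R) \<le> enat c * Path irstep R (WIDG F ar R) (sharp t)"
  proof (intro exI ballI impI)
    fix t assume "t \<in> basic_terms F ar R"
    from inner.basic_bound[OF this]
    show "dh t (irstep R) \<le> enat (card (path_sets inner.DG)) * Path irstep R (WIDG F ar R) (sharp t)"
      unfolding eq irstep_eq_gstep[of R] .
  qed
qed

end
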